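(* Let $R$ be a commutative Artinian principal ideal ring and let $M$ be an $R$-module with injective envelope $E = E(M)$. Then each one of the following conditions holds for $M$ if and only if it holds for $E$: (1) being Hopfian; (2) being co-Hopfian; (3) being finitely generated; (4) having finite length; (5) being Noetherian (ascending chain condition on submodules); (6) being Artinian (descending chain condition on submodules); (7) being finitely cogenerated.
   Context: All rings have $1 \neq 0$ and all modules are unital. A principal ideal ring is a ring (not necessarily a domain) in which every ideal is principal. An $R$-module $M$ is Hopfian if every surjective $R$-module endomorphism of $M$ is an isomorphism, and co-Hopfian if every injective $R$-module endomorphism of $M$ is an isomorphism. An $R$-module $M$ is finitely cogenerated if its injective envelope $E(M)$ is isomorphic to the direct sum of the injective envelopes of finitely many (possibly zero) simple $R$-modules. *)

theory Defs
  imports "HOL-Algebra.Module" "HOL-Algebra.Ideal"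
begin

section \<open>Rings\<close>

definition principal_ideal_ring :: "('r, 'k) ring_scheme \<Rightarrow> bool" where
  "principal_ideal_ring R \<longleftrightarrow> (\<forall>I. ideal I R \<longrightarrow> principalideal I R)"

definition artinian_ring :: "('r, 'k) ring_scheme \<Rightarrow> bool" where
  "artinian_ring R \<longleftrightarrow>
     (\<forall>I :: nat \<Rightarrow> 'r set. (\<forall>n. ideal (I n) R) \<and> (\<forall>n. I (Suc n) \<subseteq> I n) \<longrightarrow>
        (\<exists>n. \<forall>m\<ge>n. I m = I n))"


section \<open>Homomorphisms and direct sums of modules\<close>

definition mod_hom ::
  "('r, 'k) ring_scheme \<Rightarrow> ('r, 'a, 'x) module_scheme \<Rightarrow> ('r, 'b, 'y) module_scheme \<Rightarrow> ('a \<Rightarrow> 'b) set"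
  where
  "mod_hom R M N =
     {f \<in> carrier M \<rightarrow> carrier N.
        (\<forall>x\<in>carrier M. \<forall>y\<in>carrier M. f (x \<oplus>\<^bsub>M\<^esub> y) = f x \<oplus>\<^bsub>N\<^esub> f y) \<and>
        (\<forall>r\<in>carrier R. \<forall>x\<in>carrier M. f (r \<odot>\<^bsub>M\<^esub> x) = r \<odot>\<^bsub>N\<^esub> f x)}"

definition mod_iso ::
  "('r, 'k) ring_scheme \<Rightarrow> ('r, 'a, 'x) module_scheme \<Rightarrow> ('r, 'b, 'y) module_scheme \<Rightarrow> ('a \<Rightarrow> 'b) set"
  where "mod_iso R M N = {f \<in> mod_hom R M N. bij_betw f (carrier M) (carrier N)}"

text \<open>
  Records of type \<open>module\<close> also have multiplicative fields inherited from \<open>ring\<close>; the locale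
  \<open>module\<close> does not constrain them, and they play no role here.
\<close>

definition direct_sum :: "'i set \<Rightarrow> ('i \<Rightarrow> ('r, 'a) module) \<Rightarrow> ('r, 'i \<Rightarrow> 'a) module" where
  "direct_sum I F =
     \<lparr>carrier = {x \<in> \<Pi>\<^sub>E i\<in>I. carrier (F i). finite {i \<in> I. x i \<noteq> \<zero>\<^bsub>F i\<^esub>}},
      mult = undefined, one = undefined,
      zero = (\<lambda>i\<in>I. \<zero>\<^bsub>F i\<^esub>),
      add = (\<lambda>x y. \<lambda>i\<in>I. x i \<oplus>\<^bsub>F i\<^esub> y i),
      smult = (\<lambda>r x. \<lambda>i\<in>I. r \<odot>\<^bsub>F i\<^esub> x i)\<rparr>"


section \<open>Injective modules and injective envelopes\<close>

text \<open>
  Injectivity quantifies over all modules, which HOL can only do for one carrier type at a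
  time. \<open>injective_over TYPE('c)\<close> is the usual lifting property against
  monomorphisms \<open>A \<rightarrow> B\<close> between modules with carrier type \<open>'c\<close>. The carrier type \<open>'r\<close> of
  the ring suffices: theorem \<open>injective_module_over\<close> below shows that \<open>injective_module\<close>
  implies the lifting property for modules \<open>A\<close> and \<open>B\<close> of arbitrary carrier types.
\<close>

definition injective_over ::
  "'c itself \<Rightarrow> ('r, 'k) ring_scheme \<Rightarrow> ('r, 'e, 'x) module_scheme \<Rightarrow> bool" where
  "injective_over (_ :: 'c itself) R E \<longleftrightarrow>
     module R E \<and>
     (\<forall>(A :: ('r, 'c) module) (B :: ('r, 'c) module) f g.
        module R A \<and> module R B \<and> f \<in> mod_hom R A B \<and> inj_on f (carrier A) \<and> g \<in> mod_hom R A E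
        \<longrightarrow> (\<exists>h\<in>mod_hom R B E. \<forall>a\<in>carrier A. h (f a) = g a))"

definition injective_module :: "('r, 'k) ring_scheme \<Rightarrow> ('r, 'e, 'x) module_scheme \<Rightarrow> bool" where
  "injective_module R E \<longleftrightarrow> injective_over TYPE('r) R E"

lemma mod_homD:
  assumes "f \<in> mod_hom R M N"
  shows "x \<in> carrier M \<Longrightarrow> f x \<in> carrier N"
    and "\<lbrakk>x \<in> carrier M; y \<in> carrier M\<rbrakk> \<Longrightarrow> f (x \<oplus>\<^bsub>M\<^esub> y) = f x \<oplus>\<^bsub>N\<^esub> f y"
    and "\<lbrakk>r \<in> carrier R; x \<in> carrier M\<rbrakk> \<Longrightarrow> f (r \<odot>\<^bsub>M\<^esub> x) = r \<odot>\<^bsub>N\<^esub> f x"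
  using assms by (auto simp: mod_hom_def)

text \<open>
  Baer's argument: Zorn's lemma for graphs of partial extensions, each of which is enlarged by
  one element using the lifting property for an ideal of \<open>R\<close>.
\<close>

theorem injective_module_over:
  fixes R :: "('r, 'k) ring_scheme" and E :: "('r, 'e, 'x) module_scheme"
    and A :: "('r, 'a, 'y) module_scheme" and B :: "('r, 'b, 'z) module_scheme"
  assumes inj: "injective_module R E"
    and A: "module R A" and B: "module R B"
    and f: "f \<in> mod_hom R A B" and f_inj: "inj_on f (carrier A)" and g: "g \<in> mod_hom R A E"
  shows "\<exists>h\<in>mod_hom R B E. \<forall>a\<in>carrier A. h (f a) = g a"
proof -
  have ER: "module R E"
    using inj by (simp add: injective_module_def injective_over_def)
  interpret E: module R E by (rule ER)
  interpret A: module R A by (rule A)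
  interpret B: module R B by (rule B)
  note fD = mod_homD[OF f] and gD = mod_homD[OF g]
  define P where "P H \<longleftrightarrow> H \<subseteq> carrier B \<times> carrier E \<and>
      (\<forall>x y x' y'. (x, y) \<in> H \<longrightarrow> (x', y') \<in> H \<longrightarrow> (x \<oplus>\<^bsub>B\<^esub> x', y \<oplus>\<^bsub>E\<^esub> y') \<in> H) \<and>
      (\<forall>r x y. r \<in> carrier R \<longrightarrow> (x, y) \<in> H \<longrightarrow> (r \<odot>\<^bsub>B\<^esub> x, r \<odot>\<^bsub>E\<^esub> y) \<in> H) \<and>
      (\<forall>y. (\<zero>\<^bsub>B\<^esub>, y) \<in> H \<longrightarrow> y = \<zero>\<^bsub>E\<^esub>) \<and>
      (\<forall>a\<in>carrier A. (f a, g a) \<in> H)" for H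
  have PI: "P H" if "H \<subseteq> carrier B \<times> carrier E"
      "\<And>x y x' y'. (x, y) \<in> H \<Longrightarrow> (x', y') \<in> H \<Longrightarrow> (x \<oplus>\<^bsub>B\<^esub> x', y \<oplus>\<^bsub>E\<^esub> y') \<in> H"
      "\<And>r x y. r \<in> carrier R \<Longrightarrow> (x, y) \<in> H \<Longrightarrow> (r \<odot>\<^bsub>B\<^esub> x, r \<odot>\<^bsub>E\<^esub> y) \<in> H"
      "\<And>y. (\<zero>\<^bsub>B\<^esub>, y) \<in> H \<Longrightarrow> y = \<zero>\<^bsub>E\<^esub>"
      "\<And>a. a \<in> carrier A \<Longrightarrow> (f a, g a) \<in> H" for H
    using that unfolding P_def by blast
  have f0: "f \<zero>\<^bsub>A\<^esub> = \<zero>\<^bsub>B\<^esub>"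
    using fD(3)[of \<open>\<zero>\<^bsub>R\<^esub>\<close> \<open>\<zero>\<^bsub>A\<^esub>\<close>] fD(1)[of \<open>\<zero>\<^bsub>A\<^esub>\<close>] by simp
  have g0: "g \<zero>\<^bsub>A\<^esub> = \<zero>\<^bsub>E\<^esub>"
    using gD(3)[of \<open>\<zero>\<^bsub>R\<^esub>\<close> \<open>\<zero>\<^bsub>A\<^esub>\<close>] gD(1)[of \<open>\<zero>\<^bsub>A\<^esub>\<close>] by simp
  have P0: "P ((\<lambda>a. (f a, g a)) ` carrier A)"
  proof (rule PI)
    fix y assume "(\<zero>\<^bsub>B\<^esub>, y) \<in> (\<lambda>a. (f a, g a)) ` carrier A"
    then obtain a where a: "a \<in> carrier A" "f a = \<zero>\<^bsub>B\<^esub>" "y = g a" by auto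
    then have "a = \<zero>\<^bsub>A\<^esub>" using f_inj f0 by (metis A.zero_closed inj_onD)
    then show "y = \<zero>\<^bsub>E\<^esub>" using a g0 by simp
  next
    fix x y x' y'
    assume "(x, y) \<in> (\<lambda>a. (f a, g a)) ` carrier A" "(x', y') \<in> (\<lambda>a. (f a, g a)) ` carrier A"
    then obtain a a' where "a \<in> carrier A" "a' \<in> carrier A" "x = f a" "y = g a" "x' = f a'" "y' = g a'"
      by blast
    then show "(x \<oplus>\<^bsub>B\<^esub> x', y \<oplus>\<^bsub>E\<^esub> y') \<in> (\<lambda>a. (f a, g a)) ` carrier A"
      by (intro image_eqI[of _ _ "a \<oplus>\<^bsub>A\<^esub> a'"]) (auto simp: fD gD)
  next
    fix r x y
    assume "r \<in> carrier R" "(x, y) \<in> (\<lambda>a. (f a, g a)) ` carrier A"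
    then obtain a where "r \<in> carrier R" "a \<in> carrier A" "x = f a" "y = g a"
      by blast
    then show "(r \<odot>\<^bsub>B\<^esub> x, r \<odot>\<^bsub>E\<^esub> y) \<in> (\<lambda>a. (f a, g a)) ` carrier A"
      by (intro image_eqI[of _ _ "r \<odot>\<^bsub>A\<^esub> a"]) (auto simp: fD gD)
  qed (auto simp: fD gD)
  have "\<exists>H\<in>Collect P. \<forall>X\<in>Collect P. H \<subseteq> X \<longrightarrow> X = H"
  proof (rule subset_Zorn_nonempty)
    show "Collect P \<noteq> {}" using P0 by blast
    fix C assume C: "C \<noteq> {}" "subset.chain (Collect P) C"
    have CP: "P H" if "H \<in> C" for H
      using C(2) that by (auto simp: subset.chain_def)
    have "P (\<Union>C)"
    proof (rule PI)
      show "\<Union>C \<subseteq> carrier B \<times> carrier E" using CP unfolding P_def by blast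
      fix x y x' y' assume "(x, y) \<in> \<Union>C" "(x', y') \<in> \<Union>C"
      then obtain H H' where H: "H \<in> C" "(x, y) \<in> H" "H' \<in> C" "(x', y') \<in> H'" by blast
      have "H \<subseteq> H' \<or> H' \<subseteq> H" using C(2) H unfolding subset.chain_def by blast
      then obtain K where K: "K \<in> C" "(x, y) \<in> K" "(x', y') \<in> K" using H by blast
      then show "(x \<oplus>\<^bsub>B\<^esub> x', y \<oplus>\<^bsub>E\<^esub> y') \<in> \<Union>C"
        using CP[OF K(1)] unfolding P_def by blast
    next
      fix r x y assume "r \<in> carrier R" "(x, y) \<in> \<Union>C"
      then show "(r \<odot>\<^bsub>B\<^esub> x, r \<odot>\<^bsub>E\<^esub> y) \<in> \<Union>C" using CP unfolding P_def by blast
    next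
      fix y assume "(\<zero>\<^bsub>B\<^esub>, y) \<in> \<Union>C"
      then show "y = \<zero>\<^bsub>E\<^esub>" using CP unfolding P_def by blast
    next
      fix a assume "a \<in> carrier A"
      then show "(f a, g a) \<in> \<Union>C" using CP C(1) unfolding P_def by blast
    qed
    then show "\<Union>C \<in> Collect P" by simp
  qed
  then obtain H where PH: "P H" and H_max: "\<And>X. P X \<Longrightarrow> H \<subseteq> X \<Longrightarrow> X = H" by auto
  have H_carr: "x \<in> carrier B" "y \<in> carrier E" if "(x, y) \<in> H" for x y
    using PH that unfolding P_def by blast+
  have H_add: "(x \<oplus>\<^bsub>B\<^esub> x', y \<oplus>\<^bsub>E\<^esub> y') \<in> H" if "(x, y) \<in> H" "(x', y') \<in> H" for x y x' y'
    using PH that unfolding P_def by blast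
  have H_smult: "(r \<odot>\<^bsub>B\<^esub> x, r \<odot>\<^bsub>E\<^esub> y) \<in> H" if "r \<in> carrier R" "(x, y) \<in> H" for r x y
    using PH that unfolding P_def by blast
  have H_zero: "y = \<zero>\<^bsub>E\<^esub>" if "(\<zero>\<^bsub>B\<^esub>, y) \<in> H" for y
    using PH that unfolding P_def by blast
  have H_base: "(f a, g a) \<in> H" if "a \<in> carrier A" for a
    using PH that unfolding P_def by blast
  have H_00: "(\<zero>\<^bsub>B\<^esub>, \<zero>\<^bsub>E\<^esub>) \<in> H"
    using H_base[of "\<zero>\<^bsub>A\<^esub>"] f0 g0 by simp
  have H_neg: "(\<ominus>\<^bsub>B\<^esub> x, \<ominus>\<^bsub>E\<^esub> y) \<in> H" if "(x, y) \<in> H" for x y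
    using H_smult[of "\<ominus>\<^bsub>R\<^esub> \<one>\<^bsub>R\<^esub>" x y] that H_carr[OF that]
    by (simp add: B.smult_l_minus E.smult_l_minus)
  have H_unique: "y = y'" if "(x, y) \<in> H" "(x, y') \<in> H" for x y y'
  proof -
    have "(\<zero>\<^bsub>B\<^esub>, y \<oplus>\<^bsub>E\<^esub> \<ominus>\<^bsub>E\<^esub> y') \<in> H"
      using H_add[OF that(1) H_neg[OF that(2)]] H_carr[OF that(1)] by (simp add: B.r_neg)
    then have "y \<oplus>\<^bsub>E\<^esub> \<ominus>\<^bsub>E\<^esub> y' = \<zero>\<^bsub>E\<^esub>" by (rule H_zero)
    then show ?thesis
      using E.M.minus_equality[of y "\<ominus>\<^bsub>E\<^esub> y'"] H_carr[OF that(1)] H_carr[OF that(2)] by simp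
  qed
  have H_total: "\<exists>y. (b, y) \<in> H" if b: "b \<in> carrier B" for b
  proof -
    define I where "I = {r \<in> carrier R. \<exists>y. (r \<odot>\<^bsub>B\<^esub> b, y) \<in> H}"
    define \<phi> where "\<phi> r = (THE y. (r \<odot>\<^bsub>B\<^esub> b, y) \<in> H)" for r
    have \<phi>_eq: "\<phi> r = y" if "(r \<odot>\<^bsub>B\<^esub> b, y) \<in> H" for r y
      unfolding \<phi>_def using that H_unique by blast
    have \<phi>: "(r \<odot>\<^bsub>B\<^esub> b, \<phi> r) \<in> H" if "r \<in> I" for r
      using that \<phi>_eq by (auto simp: I_def)
    define RR :: "('r, 'r) module" where
      "RR = \<lparr>carrier = carrier R, mult = undefined, one = undefined, zero = \<zero>\<^bsub>R\<^esub>,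
             add = add R, smult = mult R\<rparr>"
    have RR: "module R RR"
    proof (rule moduleI)
      show "abelian_group RR"
        by (rule abelian_groupI)
          (auto simp: RR_def E.R.a_ac intro: bexI[of _ "\<ominus>\<^bsub>R\<^esub> _"] E.R.l_neg)
    qed (auto simp: RR_def E.R.l_distr E.R.r_distr E.R.m_assoc E.R.is_cring)
    interpret RR: module R RR by (rule RR)
    have I_carr: "I \<subseteq> carrier R" by (auto simp: I_def)
    have I_add: "r \<oplus>\<^bsub>R\<^esub> s \<in> I \<and> \<phi> (r \<oplus>\<^bsub>R\<^esub> s) = \<phi> r \<oplus>\<^bsub>E\<^esub> \<phi> s" if "r \<in> I" "s \<in> I" for r s
    proof -
      have "((r \<oplus>\<^bsub>R\<^esub> s) \<odot>\<^bsub>B\<^esub> b, \<phi> r \<oplus>\<^bsub>E\<^esub> \<phi> s) \<in> H"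
        using H_add[OF \<phi>[OF that(1)] \<phi>[OF that(2)]] that I_carr b
        by (simp add: B.smult_l_distr subset_iff)
      then show ?thesis using that \<phi>_eq by (auto simp: I_def)
    qed
    have I_smult: "s \<otimes>\<^bsub>R\<^esub> r \<in> I \<and> \<phi> (s \<otimes>\<^bsub>R\<^esub> r) = s \<odot>\<^bsub>E\<^esub> \<phi> r" if "s \<in> carrier R" "r \<in> I" for r s
    proof -
      have "((s \<otimes>\<^bsub>R\<^esub> r) \<odot>\<^bsub>B\<^esub> b, s \<odot>\<^bsub>E\<^esub> \<phi> r) \<in> H"
        using H_smult[OF that(1) \<phi>[OF that(2)]] that I_carr b
        by (simp add: B.smult_assoc1 subset_iff)
      then show ?thesis using that \<phi>_eq by (auto simp: I_def)
    qed
    have I_zero: "\<zero>\<^bsub>R\<^esub> \<in> I"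
      using H_00 b by (auto simp: I_def)
    have I_sub: "submodule I R RR"
    proof (rule RR.submoduleI)
      fix r assume r: "r \<in> I"
      then have rc: "r \<in> carrier RR" using I_carr by (auto simp: RR_def)
      have "\<ominus>\<^bsub>RR\<^esub> r = (\<ominus>\<^bsub>R\<^esub> \<one>\<^bsub>R\<^esub>) \<odot>\<^bsub>RR\<^esub> r"
        using RR.smult_l_minus[of "\<one>\<^bsub>R\<^esub>" r] rc by simp
      also have "\<dots> \<in> I" using I_smult[of "\<ominus>\<^bsub>R\<^esub> \<one>\<^bsub>R\<^esub>" r] r by (simp add: RR_def)
      finally show "\<ominus>\<^bsub>RR\<^esub> r \<in> I" .
    qed (use I_add I_smult I_zero I_carr in \<open>auto simp: RR_def\<close>)
    let ?I = "RR\<lparr>carrier := I\<rparr>"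
    have "module R ?I" by (rule submodule.submodule_is_module[OF I_sub RR])
    moreover have "(\<lambda>r. r) \<in> mod_hom R ?I RR"
      using I_carr by (auto simp: mod_hom_def RR_def)
    moreover have "\<phi> \<in> mod_hom R ?I E"
      using I_add I_smult H_carr(2)[OF \<phi>] by (auto simp: mod_hom_def RR_def)
    ultimately have "\<exists>h\<in>mod_hom R RR E. \<forall>r\<in>carrier ?I. h r = \<phi> r"
      using inj[unfolded injective_module_def injective_over_def, THEN conjunct2, rule_format,
          of ?I RR "\<lambda>r. r" \<phi>] RR by simp
    then obtain h where h: "h \<in> mod_hom R RR E" and h\<phi>: "\<And>r. r \<in> I \<Longrightarrow> h r = \<phi> r"
      by auto
    note hD = mod_homD[OF h]
    define e where "e = h \<one>\<^bsub>R\<^esub>"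
    have e: "e \<in> carrier E" using hD(1) by (simp add: e_def RR_def)
    have he: "h r = r \<odot>\<^bsub>E\<^esub> e" if "r \<in> carrier R" for r
      using hD(3)[of r "\<one>\<^bsub>R\<^esub>"] that by (simp add: e_def RR_def)
    define K where
      "K = {(x \<oplus>\<^bsub>B\<^esub> r \<odot>\<^bsub>B\<^esub> b, y \<oplus>\<^bsub>E\<^esub> r \<odot>\<^bsub>E\<^esub> e) |x y r. (x, y) \<in> H \<and> r \<in> carrier R}"
    have KI: "(x \<oplus>\<^bsub>B\<^esub> r \<odot>\<^bsub>B\<^esub> b, y \<oplus>\<^bsub>E\<^esub> r \<odot>\<^bsub>E\<^esub> e) \<in> K" if "(x, y) \<in> H" "r \<in> carrier R" for x y r
      using that by (auto simp: K_def)
    have HK: "H \<subseteq> K"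
    proof (rule subrelI)
      fix x y assume "(x, y) \<in> H"
      then show "(x, y) \<in> K" using KI[of x y "\<zero>\<^bsub>R\<^esub>"] H_carr b e by simp
    qed
    have "P K"
    proof (rule PI)
      show "K \<subseteq> carrier B \<times> carrier E" using H_carr b e by (auto simp: K_def)
      fix x y x' y' assume "(x, y) \<in> K" "(x', y') \<in> K"
      then obtain u v r u' v' r' where *: "(u, v) \<in> H" "r \<in> carrier R" "(u', v') \<in> H" "r' \<in> carrier R"
        "x = u \<oplus>\<^bsub>B\<^esub> r \<odot>\<^bsub>B\<^esub> b" "y = v \<oplus>\<^bsub>E\<^esub> r \<odot>\<^bsub>E\<^esub> e"
        "x' = u' \<oplus>\<^bsub>B\<^esub> r' \<odot>\<^bsub>B\<^esub> b" "y' = v' \<oplus>\<^bsub>E\<^esub> r' \<odot>\<^bsub>E\<^esub> e"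
        unfolding K_def by blast
      show "(x \<oplus>\<^bsub>B\<^esub> x', y \<oplus>\<^bsub>E\<^esub> y') \<in> K"
        using KI[OF H_add[OF *(1,3)], of "r \<oplus>\<^bsub>R\<^esub> r'"] * H_carr[OF *(1)] H_carr[OF *(3)] b e
        by (simp add: B.smult_l_distr E.smult_l_distr B.M.a_ac E.M.a_ac)
    next
      fix s x y assume s: "s \<in> carrier R" and "(x, y) \<in> K"
      then obtain u v r where *: "(u, v) \<in> H" "r \<in> carrier R"
        "x = u \<oplus>\<^bsub>B\<^esub> r \<odot>\<^bsub>B\<^esub> b" "y = v \<oplus>\<^bsub>E\<^esub> r \<odot>\<^bsub>E\<^esub> e"
        unfolding K_def by blast
      show "(s \<odot>\<^bsub>B\<^esub> x, s \<odot>\<^bsub>E\<^esub> y) \<in> K"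
        using KI[OF H_smult[OF s *(1)], of "s \<otimes>\<^bsub>R\<^esub> r"] * s H_carr[OF *(1)] b e
        by (simp add: B.smult_r_distr E.smult_r_distr B.smult_assoc1 E.smult_assoc1)
    next
      fix y assume "(\<zero>\<^bsub>B\<^esub>, y) \<in> K"
      then obtain u v r where *: "(u, v) \<in> H" "r \<in> carrier R"
        "u \<oplus>\<^bsub>B\<^esub> r \<odot>\<^bsub>B\<^esub> b = \<zero>\<^bsub>B\<^esub>" "y = v \<oplus>\<^bsub>E\<^esub> r \<odot>\<^bsub>E\<^esub> e"
        unfolding K_def by force
      note uv = H_carr[OF *(1)]
      have "r \<odot>\<^bsub>B\<^esub> b = \<ominus>\<^bsub>B\<^esub> u"
        using B.M.minus_equality[of "r \<odot>\<^bsub>B\<^esub> b" u] *(2,3) uv b by (simp add: B.M.a_comm)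
      then have rb: "(r \<odot>\<^bsub>B\<^esub> b, \<ominus>\<^bsub>E\<^esub> v) \<in> H" using H_neg[OF *(1)] by simp
      then have "r \<in> I" using *(2) by (auto simp: I_def)
      then have "r \<odot>\<^bsub>E\<^esub> e = \<ominus>\<^bsub>E\<^esub> v" using h\<phi> he[OF *(2)] \<phi>_eq[OF rb] by simp
      then show "y = \<zero>\<^bsub>E\<^esub>" using *(4) uv by (simp add: E.M.r_neg)
    next
      fix a assume "a \<in> carrier A"
      then show "(f a, g a) \<in> K" using H_base HK by blast
    qed
    then have "K = H" using HK by (rule H_max)
    moreover have "(b, e) \<in> K" using KI[OF H_00, of "\<one>\<^bsub>R\<^esub>"] b e by simp
    ultimately show ?thesis by blast
  qed
  define h where "h b = (THE y. (b, y) \<in> H)" for b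
  have h_eq: "h b = y" if "(b, y) \<in> H" for b y
    unfolding h_def using that H_unique by blast
  have h: "(b, h b) \<in> H" if "b \<in> carrier B" for b
    using H_total[OF that] h_eq by blast
  have "h \<in> mod_hom R B E"
    unfolding mod_hom_def using h H_carr(2)[OF h] by (auto intro!: h_eq H_add H_smult)
  moreover have "h (f a) = g a" if "a \<in> carrier A" for a
    by (rule h_eq[OF H_base[OF that]])
  ultimately show ?thesis by blast
qed

definition essential_submodule ::
  "'e set \<Rightarrow> ('r, 'k) ring_scheme \<Rightarrow> ('r, 'e, 'x) module_scheme \<Rightarrow> bool" where
  "essential_submodule H R E \<longleftrightarrow>
     submodule H R E \<and> (\<forall>N. submodule N R E \<and> N \<noteq> {\<zero>\<^bsub>E\<^esub>} \<longrightarrow> H \<inter> N \<noteq> {\<zero>\<^bsub>E\<^esub>})"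

definition injective_envelope ::
  "('r, 'k) ring_scheme \<Rightarrow> ('r, 'm, 'x) module_scheme \<Rightarrow> ('r, 'e, 'y) module_scheme \<Rightarrow>
   ('m \<Rightarrow> 'e) \<Rightarrow> bool" where
  "injective_envelope R M E i \<longleftrightarrow>
     module R M \<and> injective_module R E \<and>
     i \<in> mod_hom R M E \<and> inj_on i (carrier M) \<and> essential_submodule (i ` carrier M) R E"


section \<open>Properties of modules\<close>

definition hopfian :: "('r, 'k) ring_scheme \<Rightarrow> ('r, 'm, 'x) module_scheme \<Rightarrow> bool" where
  "hopfian R M \<longleftrightarrow>
     (\<forall>f\<in>mod_hom R M M. f ` carrier M = carrier M \<longrightarrow> f \<in> mod_iso R M M)"

definition co_hopfian :: "('r, 'k) ring_scheme \<Rightarrow> ('r, 'm, 'x) module_scheme \<Rightarrow> bool" where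
  "co_hopfian R M \<longleftrightarrow>
     (\<forall>f\<in>mod_hom R M M. inj_on f (carrier M) \<longrightarrow> f \<in> mod_iso R M M)"

definition finitely_generated :: "('r, 'k) ring_scheme \<Rightarrow> ('r, 'm, 'x) module_scheme \<Rightarrow> bool" where
  "finitely_generated R M \<longleftrightarrow>
     (\<exists>A. finite A \<and> A \<subseteq> carrier M \<and>
        (\<forall>x\<in>carrier M. \<exists>c\<in>A \<rightarrow> carrier R. x = (\<Oplus>\<^bsub>M\<^esub>a\<in>A. c a \<odot>\<^bsub>M\<^esub> a)))"

text \<open>
  A composition series is a finite chain of submodules from \<open>0\<close> to \<open>M\<close> that cannot be
  refined; equivalently, its factors are simple.
\<close>

definition finite_length :: "('r, 'k) ring_scheme \<Rightarrow> ('r, 'm, 'x) module_scheme \<Rightarrow> bool" where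
  "finite_length R M \<longleftrightarrow>
     (\<exists>n (N :: nat \<Rightarrow> 'm set).
        N 0 = {\<zero>\<^bsub>M\<^esub>} \<and> N n = carrier M \<and> (\<forall>k\<le>n. submodule (N k) R M) \<and>
        (\<forall>k<n. N k \<subset> N (Suc k) \<and> \<not> (\<exists>H. submodule H R M \<and> N k \<subset> H \<and> H \<subset> N (Suc k))))"

definition noetherian_module :: "('r, 'k) ring_scheme \<Rightarrow> ('r, 'm, 'x) module_scheme \<Rightarrow> bool" where
  "noetherian_module R M \<longleftrightarrow>
     (\<forall>N :: nat \<Rightarrow> 'm set. (\<forall>n. submodule (N n) R M) \<and> (\<forall>n. N n \<subseteq> N (Suc n)) \<longrightarrow>
        (\<exists>n. \<forall>m\<ge>n. N m = N n))"

definition artinian_module :: "('r, 'k) ring_scheme \<Rightarrow> ('r, 'm, 'x) module_scheme \<Rightarrow> bool" where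
  "artinian_module R M \<longleftrightarrow>
     (\<forall>N :: nat \<Rightarrow> 'm set. (\<forall>n. submodule (N n) R M) \<and> (\<forall>n. N (Suc n) \<subseteq> N n) \<longrightarrow>
        (\<exists>n. \<forall>m\<ge>n. N m = N n))"

definition simple_module :: "('r, 'k) ring_scheme \<Rightarrow> ('r, 'm, 'x) module_scheme \<Rightarrow> bool" where
  "simple_module R S \<longleftrightarrow>
     module R S \<and> carrier S \<noteq> {\<zero>\<^bsub>S\<^esub>} \<and>
     (\<forall>H. submodule H R S \<longrightarrow> H = {\<zero>\<^bsub>S\<^esub>} \<or> H = carrier S)"

text \<open>
  The type \<open>'e\<close> only says in which carrier type the injective envelope \<open>E(M)\<close> is taken. As
  envelopes are unique up to isomorphism, the notion does not depend on \<open>'e\<close> as long as \<open>M\<close>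
  has some injective envelope with carrier type \<open>'e\<close>. The simple modules \<open>S k\<close> and their
  envelopes \<open>F k\<close> can be taken with carrier type \<open>'e\<close> without loss of generality, since the
  summands of a direct sum isomorphic to \<open>E(M)\<close> embed in \<open>E(M)\<close>.
\<close>

definition finitely_cogenerated ::
  "'e itself \<Rightarrow> ('r, 'k) ring_scheme \<Rightarrow> ('r, 'm, 'x) module_scheme \<Rightarrow> bool" where
  "finitely_cogenerated (_ :: 'e itself) R M \<longleftrightarrow>
     (\<exists>(E :: ('r, 'e) module) i. injective_envelope R M E i \<and>
        (\<exists>(n :: nat) (S :: nat \<Rightarrow> ('r, 'e) module) (F :: nat \<Rightarrow> ('r, 'e) module) j.
           (\<forall>k<n. simple_module R (S k) \<and> injective_envelope R (S k) (F k) (j k)) \<and>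
           mod_iso R E (direct_sum {..<n} F) \<noteq> {}))"

end

theory Submission
  imports Defs
begin

text \<open>
  For modules over such a ring, conditions (1)--(6) all say that the module has finite length, and
  finite length is detected on the socle, which \<open>M\<close> and \<open>E(M)\<close> share. Indeed, \<open>0\<close> is a product of
  generators \<open>p\<close> of maximal ideals, and multiplication by \<open>p\<close> has the \<open>p\<close>-socle as its kernel, so a
  module has finite length as soon as all its \<open>p\<close>-socles do.

  If \<open>M\<close> has infinite length, then for some \<open>p\<close> and \<open>k\<close> there are elements \<open>x\<^sub>0, x\<^sub>1, \<dots>\<close> killed by
  \<open>p\<close> to the power \<open>k + 1\<close> whose multiples \<open>p\<^sup>k x\<^sub>j\<close> are independent modulo \<open>p\<^sup>k\<^sup>+\<^sup>1 M\<close>. Their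
  span is an infinite direct sum of isomorphic cyclic modules and splits off from \<open>M\<close>; shifting the
  summands shows that \<open>M\<close> is neither Hopfian nor co-Hopfian.

  Condition (7) only refers to the injective envelope, and \<open>M\<close> and \<open>E(M)\<close> have the same ones.
\<close>

section \<open>Submodules and homomorphisms\<close>

text \<open>Being Hopfian or co-Hopfian does not visibly pass to submodules or quotients, so
  infinite length has to be turned into a direct summand: there an endomorphism can be prolonged by
  the identity on a complement. The exponent \<open>k\<close> comes from filtering the p-socle by
  its intersections with the submodules p^k M. The filtration ends at zero because the ideals of the
  powers of \<open>p\<close> become stationary, so a socle of infinite length has a layer of
  infinite dimension over the residue field. An independent sequence of that layer consists of
  multiples p^k x_j, and its independence modulo the next layer is what lets the span of the x_j
  split off. Principality enters through the single scalar \<open>p\<close>: the part killed by a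
  maximal ideal is the kernel of one multiplication map, and that map moves intervals of submodules.
  A nonzero element of a p-socle generates a simple submodule, which every essential submodule
  contains; hence the common socle. Quotient modules are never formed; intervals of submodules stand
  for them.\<close>

definition scalar_kernel :: "('r, 'k) ring_scheme \<Rightarrow> ('r, 'a, 'x) module_scheme \<Rightarrow> 'r \<Rightarrow> 'a set" where
  "scalar_kernel R M a = {x \<in> carrier M. a \<odot>\<^bsub>M\<^esub> x = \<zero>\<^bsub>M\<^esub>}"

definition scalar_image :: "('r, 'a, 'x) module_scheme \<Rightarrow> 'r \<Rightarrow> 'a set \<Rightarrow> 'a set" where
  "scalar_image M a H = (\<lambda>x. a \<odot>\<^bsub>M\<^esub> x) ` H"

definition cyclic_submodule :: "('r, 'k) ring_scheme \<Rightarrow> ('r, 'a, 'x) module_scheme \<Rightarrow> 'a \<Rightarrow> 'a set" where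
  "cyclic_submodule R M x = (\<lambda>r. r \<odot>\<^bsub>M\<^esub> x) ` carrier R"

lemma mem_set_add: "z \<in> H <+>\<^bsub>M\<^esub> K \<longleftrightarrow> (\<exists>h\<in>H. \<exists>k\<in>K. z = h \<oplus>\<^bsub>M\<^esub> k)"
  by (auto simp: set_add_def')

lemma set_add_mono_left: "A \<subseteq> B \<Longrightarrow> A <+>\<^bsub>M\<^esub> C \<subseteq> B <+>\<^bsub>M\<^esub> C"
  by (auto simp: set_add_def')

context module
begin

lemma submoduleI':
  assumes "H \<subseteq> carrier M" "\<zero>\<^bsub>M\<^esub> \<in> H"
    and "\<And>x y. x \<in> H \<Longrightarrow> y \<in> H \<Longrightarrow> x \<oplus>\<^bsub>M\<^esub> y \<in> H"
    and sm: "\<And>r x. r \<in> carrier R \<Longrightarrow> x \<in> H \<Longrightarrow> r \<odot>\<^bsub>M\<^esub> x \<in> H"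
  shows "submodule H R M"
proof (rule submoduleI)
  fix x assume x: "x \<in> H"
  then have "(\<ominus> \<one>) \<odot>\<^bsub>M\<^esub> x \<in> H" by (intro sm) auto
  then show "\<ominus>\<^bsub>M\<^esub> x \<in> H" using smult_l_minus[of \<one> x] x assms(1) by auto
qed (use assms in auto)

lemma
  assumes "submodule H R M"
  shows submodule_zero: "\<zero>\<^bsub>M\<^esub> \<in> H"
    and submodule_carrier: "x \<in> H \<Longrightarrow> x \<in> carrier M"
    and submodule_add: "x \<in> H \<Longrightarrow> y \<in> H \<Longrightarrow> x \<oplus>\<^bsub>M\<^esub> y \<in> H"
    and submodule_smult: "r \<in> carrier R \<Longrightarrow> x \<in> H \<Longrightarrow> r \<odot>\<^bsub>M\<^esub> x \<in> H"
    and submodule_minus: "x \<in> H \<Longrightarrow> y \<in> H \<Longrightarrow> x \<ominus>\<^bsub>M\<^esub> y \<in> H"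
proof -
  note E = submoduleE[OF assms]
  show c: "x \<in> H \<Longrightarrow> x \<in> carrier M" for x using E(1) by blast
  show "\<zero>\<^bsub>M\<^esub> \<in> H" using E(2,4) c by (metis R.zero_closed all_not_in_conv smult_l_null)
  show "x \<in> H \<Longrightarrow> y \<in> H \<Longrightarrow> x \<oplus>\<^bsub>M\<^esub> y \<in> H" using E(5) .
  show "x \<in> H \<Longrightarrow> y \<in> H \<Longrightarrow> x \<ominus>\<^bsub>M\<^esub> y \<in> H" using E(3,5) by (simp add: a_minus_def)
  show "r \<in> carrier R \<Longrightarrow> x \<in> H \<Longrightarrow> r \<odot>\<^bsub>M\<^esub> x \<in> H" using E(4) .
qed

lemma minus_add_cancel: "x \<in> carrier M \<Longrightarrow> y \<in> carrier M \<Longrightarrow> (x \<oplus>\<^bsub>M\<^esub> y) \<ominus>\<^bsub>M\<^esub> y = x"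
  and add_minus_cancel: "x \<in> carrier M \<Longrightarrow> y \<in> carrier M \<Longrightarrow> y \<oplus>\<^bsub>M\<^esub> (x \<ominus>\<^bsub>M\<^esub> y) = x"
  and minus_eq_zero_iff: "x \<in> carrier M \<Longrightarrow> y \<in> carrier M \<Longrightarrow> x \<ominus>\<^bsub>M\<^esub> y = \<zero>\<^bsub>M\<^esub> \<longleftrightarrow> x = y"
proof -
  show "(x \<oplus>\<^bsub>M\<^esub> y) \<ominus>\<^bsub>M\<^esub> y = x" if "x \<in> carrier M" "y \<in> carrier M"
    using that by (simp add: a_minus_def M.a_assoc M.r_neg)
  show "y \<oplus>\<^bsub>M\<^esub> (x \<ominus>\<^bsub>M\<^esub> y) = x" if "x \<in> carrier M" "y \<in> carrier M"
    using that by (simp add: a_minus_def M.a_lcomm M.r_neg)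
  then show "x \<ominus>\<^bsub>M\<^esub> y = \<zero>\<^bsub>M\<^esub> \<longleftrightarrow> x = y" if "x \<in> carrier M" "y \<in> carrier M"
    using that by (metis M.r_zero M.r_neg a_minus_def)
qed

lemma smult_minus_right:
  "r \<in> carrier R \<Longrightarrow> x \<in> carrier M \<Longrightarrow> y \<in> carrier M \<Longrightarrow>
   r \<odot>\<^bsub>M\<^esub> (x \<ominus>\<^bsub>M\<^esub> y) = r \<odot>\<^bsub>M\<^esub> x \<ominus>\<^bsub>M\<^esub> r \<odot>\<^bsub>M\<^esub> y"
  by (simp add: a_minus_def smult_r_distr smult_r_minus)

lemma smult_commute:
  "r \<in> carrier R \<Longrightarrow> s \<in> carrier R \<Longrightarrow> x \<in> carrier M \<Longrightarrow>
   r \<odot>\<^bsub>M\<^esub> (s \<odot>\<^bsub>M\<^esub> x) = s \<odot>\<^bsub>M\<^esub> (r \<odot>\<^bsub>M\<^esub> x)"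
  by (metis R.m_comm smult_assoc1)

lemma submodule_trivial: "submodule {\<zero>\<^bsub>M\<^esub>} R M"
  by (rule submoduleI') auto

lemma submodule_inter: "submodule H R M \<Longrightarrow> submodule K R M \<Longrightarrow> submodule (H \<inter> K) R M"
  by (rule submoduleI')
    (auto intro: submodule_zero submodule_add submodule_smult dest: submodule_carrier)

lemma submodule_set_add:
  assumes H: "submodule H R M" and K: "submodule K R M"
  shows "submodule (H <+>\<^bsub>M\<^esub> K) R M"
proof (rule submoduleI')
  show "H <+>\<^bsub>M\<^esub> K \<subseteq> carrier M"
    by (auto simp: mem_set_add submodule_carrier[OF H] submodule_carrier[OF K])
  show "\<zero>\<^bsub>M\<^esub> \<in> H <+>\<^bsub>M\<^esub> K"
    using submodule_zero[OF H] submodule_zero[OF K] by (force simp: mem_set_add)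
  fix x y assume "x \<in> H <+>\<^bsub>M\<^esub> K" "y \<in> H <+>\<^bsub>M\<^esub> K"
  then obtain h k h' k' where *: "h \<in> H" "k \<in> K" "h' \<in> H" "k' \<in> K"
    "x = h \<oplus>\<^bsub>M\<^esub> k" "y = h' \<oplus>\<^bsub>M\<^esub> k'" by (auto simp: mem_set_add)
  then have "x \<oplus>\<^bsub>M\<^esub> y = (h \<oplus>\<^bsub>M\<^esub> h') \<oplus>\<^bsub>M\<^esub> (k \<oplus>\<^bsub>M\<^esub> k')"
    by (simp add: submodule_carrier[OF H] submodule_carrier[OF K] M.a_ac)
  then show "x \<oplus>\<^bsub>M\<^esub> y \<in> H <+>\<^bsub>M\<^esub> K"
    using * submodule_add[OF H] submodule_add[OF K] unfolding mem_set_add by blast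
next
  fix r x assume "r \<in> carrier R" "x \<in> H <+>\<^bsub>M\<^esub> K"
  then show "r \<odot>\<^bsub>M\<^esub> x \<in> H <+>\<^bsub>M\<^esub> K"
    using submodule_smult[OF H] submodule_smult[OF K]
    by (fastforce simp: mem_set_add smult_r_distr
        submodule_carrier[OF H] submodule_carrier[OF K])
qed

lemma set_add_upper:
  assumes H: "submodule H R M" and K: "submodule K R M"
  shows "H \<subseteq> H <+>\<^bsub>M\<^esub> K" "K \<subseteq> H <+>\<^bsub>M\<^esub> K"
proof
  fix x assume "x \<in> H"
  then show "x \<in> H <+>\<^bsub>M\<^esub> K"
    using submodule_zero[OF K] submodule_carrier[OF H] by (force simp: mem_set_add)
next
  show "K \<subseteq> H <+>\<^bsub>M\<^esub> K"
  proof
    fix x assume "x \<in> K"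
    then show "x \<in> H <+>\<^bsub>M\<^esub> K"
      using submodule_zero[OF H] submodule_carrier[OF K] by (force simp: mem_set_add)
  qed
qed

lemma set_add_least:
  assumes "submodule L R M" "H \<subseteq> L" "K \<subseteq> L"
  shows "H <+>\<^bsub>M\<^esub> K \<subseteq> L"
  using assms(2,3) by (auto simp: mem_set_add intro!: submodule_add[OF assms(1)])

lemma submodule_cyclic: "x \<in> carrier M \<Longrightarrow> submodule (cyclic_submodule R M x) R M"
proof (rule submoduleI')
  assume x: "x \<in> carrier M"
  show "cyclic_submodule R M x \<subseteq> carrier M" using x by (auto simp: cyclic_submodule_def)
  show "\<zero>\<^bsub>M\<^esub> \<in> cyclic_submodule R M x"
    using x by (auto simp: cyclic_submodule_def intro!: image_eqI[of _ _ \<zero>])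
  fix y z assume "y \<in> cyclic_submodule R M x" "z \<in> cyclic_submodule R M x"
  then show "y \<oplus>\<^bsub>M\<^esub> z \<in> cyclic_submodule R M x"
    using x by (auto simp: cyclic_submodule_def smult_l_distr[symmetric])
next
  fix r y assume "x \<in> carrier M" "r \<in> carrier R" "y \<in> cyclic_submodule R M x"
  then show "r \<odot>\<^bsub>M\<^esub> y \<in> cyclic_submodule R M x"
    by (auto simp: cyclic_submodule_def smult_assoc1[symmetric])
qed

lemma cyclic_self: "x \<in> carrier M \<Longrightarrow> x \<in> cyclic_submodule R M x"
  by (auto simp: cyclic_submodule_def intro!: image_eqI[of _ _ \<one>])

lemma cyclic_least: "submodule L R M \<Longrightarrow> x \<in> L \<Longrightarrow> cyclic_submodule R M x \<subseteq> L"
  by (auto simp: cyclic_submodule_def submodule_smult)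

lemma submodule_scalar_kernel: "a \<in> carrier R \<Longrightarrow> submodule (scalar_kernel R M a) R M"
  by (rule submoduleI') (auto simp: scalar_kernel_def smult_r_distr smult_commute[of a])

lemma submodule_scalar_image:
  assumes a: "a \<in> carrier R" and H: "submodule H R M"
  shows "submodule (scalar_image M a H) R M"
proof (rule submoduleI')
  show "scalar_image M a H \<subseteq> carrier M"
    using a submodule_carrier[OF H] by (auto simp: scalar_image_def)
  show "\<zero>\<^bsub>M\<^esub> \<in> scalar_image M a H"
    using a submodule_zero[OF H] by (auto simp: scalar_image_def intro!: image_eqI[of _ _ "\<zero>\<^bsub>M\<^esub>"])
  fix x y assume "x \<in> scalar_image M a H" "y \<in> scalar_image M a H"
  then show "x \<oplus>\<^bsub>M\<^esub> y \<in> scalar_image M a H"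
    using a submodule_add[OF H] submodule_carrier[OF H]
    by (auto simp: scalar_image_def smult_r_distr[symmetric])
next
  fix r x assume "r \<in> carrier R" "x \<in> scalar_image M a H"
  then show "r \<odot>\<^bsub>M\<^esub> x \<in> scalar_image M a H"
    using a submodule_smult[OF H] submodule_carrier[OF H]
    by (auto simp: scalar_image_def smult_commute[of _ a])
qed

end

lemma
  assumes M: "module R M" and N: "module R N" and f: "f \<in> mod_hom R M N"
  shows mod_hom_zero: "f \<zero>\<^bsub>M\<^esub> = \<zero>\<^bsub>N\<^esub>"
    and mod_hom_minus:
      "x \<in> carrier M \<Longrightarrow> y \<in> carrier M \<Longrightarrow> f (x \<ominus>\<^bsub>M\<^esub> y) = f x \<ominus>\<^bsub>N\<^esub> f y"
    and mod_hom_image: "submodule H R M \<Longrightarrow> submodule (f ` H) R N"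
    and mod_hom_vimage: "submodule K R N \<Longrightarrow> submodule {x \<in> carrier M. f x \<in> K} R M"
    and mod_hom_inj_onI: "(\<And>x. x \<in> carrier M \<Longrightarrow> f x = \<zero>\<^bsub>N\<^esub> \<Longrightarrow> x = \<zero>\<^bsub>M\<^esub>) \<Longrightarrow> inj_on f (carrier M)"
proof -
  interpret M: module R M by (rule M)
  interpret N: module R N by (rule N)
  note fD = mod_homD[OF f]
  show f0: "f \<zero>\<^bsub>M\<^esub> = \<zero>\<^bsub>N\<^esub>"
    using fD(3)[of "\<zero>\<^bsub>R\<^esub>" "\<zero>\<^bsub>M\<^esub>"] fD(1)[of "\<zero>\<^bsub>M\<^esub>"] by simp
  have neg: "f (\<ominus>\<^bsub>M\<^esub> y) = \<ominus>\<^bsub>N\<^esub> f y" if "y \<in> carrier M" for y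
    using fD(3)[of "\<ominus>\<^bsub>R\<^esub> \<one>\<^bsub>R\<^esub>" y] fD(1) that by (simp add: M.smult_l_minus N.smult_l_minus)
  show minus: "f (x \<ominus>\<^bsub>M\<^esub> y) = f x \<ominus>\<^bsub>N\<^esub> f y" if "x \<in> carrier M" "y \<in> carrier M" for x y
    using that by (simp add: a_minus_def fD neg)
  show "submodule (f ` H) R N" if H: "submodule H R M"
  proof (rule N.submoduleI')
    show "f ` H \<subseteq> carrier N" using fD(1) M.submodule_carrier[OF H] by auto
    show "\<zero>\<^bsub>N\<^esub> \<in> f ` H" using f0 M.submodule_zero[OF H] by (metis imageI)
    fix x y assume "x \<in> f ` H" "y \<in> f ` H"
    then show "x \<oplus>\<^bsub>N\<^esub> y \<in> f ` H"
      using M.submodule_add[OF H] M.submodule_carrier[OF H] by (auto simp: fD(2)[symmetric])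
  next
    fix r x assume "r \<in> carrier R" "x \<in> f ` H"
    then show "r \<odot>\<^bsub>N\<^esub> x \<in> f ` H"
      using M.submodule_smult[OF H] M.submodule_carrier[OF H] by (auto simp: fD(3)[symmetric])
  qed
  show "submodule {x \<in> carrier M. f x \<in> K} R M" if K: "submodule K R N"
    by (rule M.submoduleI')
      (auto simp: f0 fD N.submodule_zero[OF K] N.submodule_add[OF K] N.submodule_smult[OF K])
  show "inj_on f (carrier M)" if *: "\<And>x. x \<in> carrier M \<Longrightarrow> f x = \<zero>\<^bsub>N\<^esub> \<Longrightarrow> x = \<zero>\<^bsub>M\<^esub>"
  proof (rule inj_onI)
    fix x y assume "x \<in> carrier M" "y \<in> carrier M" "f x = f y"
    then show "x = y"
      using *[of "x \<ominus>\<^bsub>M\<^esub> y"] fD(1) by (simp add: minus N.minus_eq_zero_iff M.minus_eq_zero_iff)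
  qed
qed

lemma mod_hom_comp:
  "f \<in> mod_hom R M N \<Longrightarrow> g \<in> mod_hom R N P \<Longrightarrow> (\<lambda>x. g (f x)) \<in> mod_hom R M P"
  by (auto simp: mod_hom_def Pi_iff)

lemma mod_hom_funpow: "f \<in> mod_hom R M M \<Longrightarrow> f ^^ n \<in> mod_hom R M M"
  by (induction n) (auto simp: mod_hom_def Pi_iff)

section \<open>Rank functions on intervals of submodules\<close>

text \<open>
  A strictly monotone rank with values in the naturals is finite length in a form that passes
  through extensions without counting the steps of chains.
\<close>

definition ranked ::
  "('r, 'k) ring_scheme \<Rightarrow> ('r, 'a, 'x) module_scheme \<Rightarrow> 'a set \<Rightarrow> 'a set \<Rightarrow> bool" where
  "ranked R M A B \<longleftrightarrow>
     (\<exists>d :: 'a set \<Rightarrow> nat. \<forall>H K. submodule H R M \<longrightarrow> submodule K R M \<longrightarrow>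
        A \<subseteq> H \<longrightarrow> H \<subset> K \<longrightarrow> K \<subseteq> B \<longrightarrow> d H < d K)"

lemma rankedI:
  assumes "\<And>H K. submodule H R M \<Longrightarrow> submodule K R M \<Longrightarrow> A \<subseteq> H \<Longrightarrow> H \<subset> K \<Longrightarrow> K \<subseteq> B \<Longrightarrow>
    d H < (d K :: nat)"
  shows "ranked R M A B"
  using assms unfolding ranked_def by blast

lemma rankedE:
  assumes "ranked R M A B"
  obtains d :: "'a set \<Rightarrow> nat" where
    "\<And>H K. submodule H R M \<Longrightarrow> submodule K R M \<Longrightarrow> A \<subseteq> H \<Longrightarrow> H \<subset> K \<Longrightarrow> K \<subseteq> B \<Longrightarrow> d H < d K"
    "\<And>H K. submodule H R M \<Longrightarrow> submodule K R M \<Longrightarrow> A \<subseteq> H \<Longrightarrow> H \<subseteq> K \<Longrightarrow> K \<subseteq> B \<Longrightarrow> d H \<le> d K"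
proof -
  obtain d :: "'a set \<Rightarrow> nat" where
    d: "\<And>H K. submodule H R M \<Longrightarrow> submodule K R M \<Longrightarrow> A \<subseteq> H \<Longrightarrow> H \<subset> K \<Longrightarrow> K \<subseteq> B \<Longrightarrow> d H < d K"
    using assms unfolding ranked_def by blast
  show ?thesis by (rule that[OF d]) (auto, metis d less_imp_le order_refl psubsetI)
qed

lemma ranked_mono: "ranked R M A B \<Longrightarrow> A \<subseteq> A' \<Longrightarrow> B' \<subseteq> B \<Longrightarrow> ranked R M A' B'"
  unfolding ranked_def by (meson order_trans)

context module
begin

lemma ranked_refl: "ranked R M A A"
  by (rule rankedI[where d = "\<lambda>_. 0"]) auto

text \<open>By the modular law, submodules \<open>H\<close> inside \<open>K\<close> with the same
  intersection with \<open>B\<close> and the same sum with \<open>B\<close> are equal. So along a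
  strict inclusion at least one of the two summands of the new rank grows, and neither
  falls.\<close>

lemma ranked_trans:
  assumes B: "submodule B R M" and AB: "ranked R M A B" and BC: "ranked R M B C"
    and AsubB: "A \<subseteq> B" and BsubC: "B \<subseteq> C" and C: "submodule C R M"
  shows "ranked R M A C"
proof -
  obtain d1 where d1: "\<And>H K. submodule H R M \<Longrightarrow> submodule K R M \<Longrightarrow> A \<subseteq> H \<Longrightarrow> H \<subset> K \<Longrightarrow> K \<subseteq> B \<Longrightarrow> d1 H < d1 K"
    "\<And>H K. submodule H R M \<Longrightarrow> submodule K R M \<Longrightarrow> A \<subseteq> H \<Longrightarrow> H \<subseteq> K \<Longrightarrow> K \<subseteq> B \<Longrightarrow> d1 H \<le> (d1 K :: nat)"
    by (rule rankedE[OF AB], rule that)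
  obtain d2 where d2: "\<And>H K. submodule H R M \<Longrightarrow> submodule K R M \<Longrightarrow> B \<subseteq> H \<Longrightarrow> H \<subset> K \<Longrightarrow> K \<subseteq> C \<Longrightarrow> d2 H < d2 K"
    "\<And>H K. submodule H R M \<Longrightarrow> submodule K R M \<Longrightarrow> B \<subseteq> H \<Longrightarrow> H \<subseteq> K \<Longrightarrow> K \<subseteq> C \<Longrightarrow> d2 H \<le> (d2 K :: nat)"
    by (rule rankedE[OF BC], rule that)
  show ?thesis
  proof (rule rankedI[where d = "\<lambda>H. d1 (H \<inter> B) + d2 (H <+>\<^bsub>M\<^esub> B)"])
    fix H K assume H: "submodule H R M" and K: "submodule K R M"
      and sub: "A \<subseteq> H" "H \<subset> K" "K \<subseteq> C"
    have sums: "submodule (H <+>\<^bsub>M\<^esub> B) R M" "submodule (K <+>\<^bsub>M\<^esub> B) R M"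
      "B \<subseteq> H <+>\<^bsub>M\<^esub> B" "K <+>\<^bsub>M\<^esub> B \<subseteq> C"
      using submodule_set_add H K B set_add_upper set_add_least[OF C] sub BsubC by auto
    have HK: "H <+>\<^bsub>M\<^esub> B \<subseteq> K <+>\<^bsub>M\<^esub> B" using set_add_mono_left[of H K] sub(2) by blast
    have *: "submodule (H \<inter> B) R M" "submodule (K \<inter> B) R M" "A \<subseteq> H \<inter> B" "H \<inter> B \<subseteq> K \<inter> B"
      using submodule_inter H K B sub AsubB by auto
    have le: "d1 (H \<inter> B) \<le> d1 (K \<inter> B)" "d2 (H <+>\<^bsub>M\<^esub> B) \<le> d2 (K <+>\<^bsub>M\<^esub> B)"
      using d1(2)[OF *] d2(2)[OF sums(1,2,3) HK sums(4)] by auto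
    have "H \<inter> B \<noteq> K \<inter> B \<or> H <+>\<^bsub>M\<^esub> B \<noteq> K <+>\<^bsub>M\<^esub> B"
    proof (rule ccontr)
      assume "\<not> ?thesis"
      then have eq: "H \<inter> B = K \<inter> B" "H <+>\<^bsub>M\<^esub> B = K <+>\<^bsub>M\<^esub> B" by auto
      have "K \<subseteq> H"
      proof
        fix x assume x: "x \<in> K"
        then obtain h b where hb: "h \<in> H" "b \<in> B" "x = h \<oplus>\<^bsub>M\<^esub> b"
          using eq(2) set_add_upper(1)[OF K B] mem_set_add[of x M H B] by blast
        have "x \<ominus>\<^bsub>M\<^esub> h \<in> K" using x hb sub submodule_minus[OF K] by auto
        moreover have "x \<ominus>\<^bsub>M\<^esub> h = b"
          using hb submodule_carrier[OF H] submodule_carrier[OF B]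
          by (simp add: minus_add_cancel M.a_comm[of h])
        ultimately have "b \<in> H" using eq(1) hb(2) by auto
        then show "x \<in> H" using hb submodule_add[OF H] by simp
      qed
      then show False using sub by auto
    qed
    then have "d1 (H \<inter> B) < d1 (K \<inter> B) \<or> d2 (H <+>\<^bsub>M\<^esub> B) < d2 (K <+>\<^bsub>M\<^esub> B)"
      using d1(1)[of "H \<inter> B" "K \<inter> B"] d2(1)[of "H <+>\<^bsub>M\<^esub> B" "K <+>\<^bsub>M\<^esub> B"] * sums HK
      by (metis Int_lower2 psubsetI)
    then show "d1 (H \<inter> B) + d2 (H <+>\<^bsub>M\<^esub> B) < d1 (K \<inter> B) + d2 (K <+>\<^bsub>M\<^esub> B)"
      using le by linarith
  qed
qed

text \<open>Two values suffice: the smaller of two distinct members of the interval is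
  \<open>A\<close>, since otherwise it would lie strictly between.\<close>

lemma ranked_cover:
  assumes "\<And>H. submodule H R M \<Longrightarrow> A \<subset> H \<Longrightarrow> H \<subset> B \<Longrightarrow> False"
  shows "ranked R M A B"
proof (rule rankedI[where d = "\<lambda>H. if H = A then 0 else 1"])
  fix H K assume "submodule H R M" "submodule K R M" "A \<subseteq> H" "H \<subset> K" "K \<subseteq> B"
  then have "H = A" using assms[of H] by auto
  then show "(if H = A then 0 else 1) < (if K = A then 0 else 1 :: nat)" using \<open>H \<subset> K\<close> by auto
qed

text \<open>Multiplication by \<open>p\<close> carries submodules between the kernel of
  \<open>p\<close> and the kernel of \<open>a \<otimes> p\<close> to submodules of the kernel of
  \<open>a\<close>. Strict inclusions survive, because a submodule that contains the kernel of
  \<open>p\<close> is determined by its image.\<close>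

lemma ranked_scalar_kernel:
  assumes a: "a \<in> carrier R" and p: "p \<in> carrier R"
    and "ranked R M {\<zero>\<^bsub>M\<^esub>} (scalar_kernel R M p)" "ranked R M {\<zero>\<^bsub>M\<^esub>} (scalar_kernel R M a)"
  shows "ranked R M {\<zero>\<^bsub>M\<^esub>} (scalar_kernel R M (a \<otimes> p))"
proof (rule ranked_trans[OF submodule_scalar_kernel[OF p]])
  have sub: "scalar_kernel R M p \<subseteq> scalar_kernel R M (a \<otimes> p)"
    using a p by (auto simp: scalar_kernel_def smult_assoc1)
  then show "scalar_kernel R M p \<subseteq> scalar_kernel R M (a \<otimes> p)" .
  obtain d where d: "\<And>H K. submodule H R M \<Longrightarrow> submodule K R M \<Longrightarrow> {\<zero>\<^bsub>M\<^esub>} \<subseteq> H \<Longrightarrow> H \<subset> K \<Longrightarrow>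
      K \<subseteq> scalar_kernel R M a \<Longrightarrow> d H < (d K :: nat)"
    by (rule rankedE[OF assms(4)], rule that)
  show "ranked R M (scalar_kernel R M p) (scalar_kernel R M (a \<otimes> p))"
  proof (rule rankedI[where d = "\<lambda>H. d (scalar_image M p H)"])
    fix H K assume H: "submodule H R M" and K: "submodule K R M"
      and sub: "scalar_kernel R M p \<subseteq> H" "H \<subset> K" "K \<subseteq> scalar_kernel R M (a \<otimes> p)"
    show "d (scalar_image M p H) < d (scalar_image M p K)"
    proof (rule d)
      show "submodule (scalar_image M p H) R M" "submodule (scalar_image M p K) R M"
        using submodule_scalar_image p H K by auto
      then show "{\<zero>\<^bsub>M\<^esub>} \<subseteq> scalar_image M p H" using submodule_zero by auto
      show "scalar_image M p K \<subseteq> scalar_kernel R M a"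
        using sub(3) a p by (auto simp: scalar_image_def scalar_kernel_def smult_assoc1)
      obtain x where x: "x \<in> K" "x \<notin> H" using sub by auto
      have "p \<odot>\<^bsub>M\<^esub> x \<notin> scalar_image M p H"
      proof
        assume "p \<odot>\<^bsub>M\<^esub> x \<in> scalar_image M p H"
        then obtain h where h: "h \<in> H" "p \<odot>\<^bsub>M\<^esub> x = p \<odot>\<^bsub>M\<^esub> h" by (auto simp: scalar_image_def)
        have c: "x \<in> carrier M" "h \<in> carrier M"
          using submodule_carrier[OF K] submodule_carrier[OF H] x h by auto
        then have "x \<ominus>\<^bsub>M\<^esub> h \<in> scalar_kernel R M p"
          using h p by (simp add: scalar_kernel_def smult_minus_right minus_eq_zero_iff)
        then have "h \<oplus>\<^bsub>M\<^esub> (x \<ominus>\<^bsub>M\<^esub> h) \<in> H" using sub h submodule_add[OF H] by auto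
        then show False using x c by (simp add: add_minus_cancel)
      qed
      then show "scalar_image M p H \<subset> scalar_image M p K"
        using x sub by (auto simp: scalar_image_def)
    qed
  qed
qed (use assms submodule_scalar_kernel in \<open>auto simp: scalar_kernel_def\<close>)

end

section \<open>Generators of maximal ideals\<close>

text \<open>Carrying a generator instead of the ideal makes the p-socle the kernel of one scalar and
  lets a power of the ideal be given by one element.\<close>

definition maximal_generator :: "('r, 'k) ring_scheme \<Rightarrow> 'r \<Rightarrow> bool" where
  "maximal_generator R p \<longleftrightarrow> p \<in> carrier R \<and> maximalideal (PIdl\<^bsub>R\<^esub> p) R"

context cring
begin

lemma maximal_generator_closed: "maximal_generator R p \<Longrightarrow> p \<in> carrier R"
  by (simp add: maximal_generator_def)

lemma maximal_generator_not_unit: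
  assumes "maximal_generator R p" "u \<in> carrier R"
  shows "u \<otimes> p \<noteq> \<one>"
proof
  assume "u \<otimes> p = \<one>"
  then have "\<one> \<in> PIdl p" using assms(2) unfolding cgenideal_def by force
  then show False
    using assms(1) ideal.one_imp_carrier maximalideal.I_notcarr maximalideal.axioms(1)
    unfolding maximal_generator_def by metis
qed

text \<open>The residue ring modulo \<open>p\<close> is a field, so \<open>r\<close> is zero or
  invertible there; invertibility is recorded as a Bezout identity. Later proofs divide by scalars
  in this way, without passing to the residue field.\<close>

lemma maximal_generator_cases:
  assumes p: "maximal_generator R p" and r: "r \<in> carrier R"
  obtains s where "s \<in> carrier R" "r = s \<otimes> p"
  | a b where "a \<in> carrier R" "b \<in> carrier R" "a \<otimes> r \<oplus> b \<otimes> p = \<one>"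
proof -
  note pc = maximal_generator_closed[OF p]
  interpret P: maximalideal "PIdl p" R using p by (simp add: maximal_generator_def)
  let ?J = "PIdl r <+>\<^bsub>R\<^esub> PIdl p"
  have J: "ideal ?J R" using add_ideals cgenideal_ideal r pc by blast
  have mem: "a \<otimes> r \<oplus> b \<otimes> p \<in> ?J" if "a \<in> carrier R" "b \<in> carrier R" for a b
    using that unfolding mem_set_add cgenideal_def by blast
  have "PIdl p \<subseteq> ?J"
  proof
    fix x assume "x \<in> PIdl p"
    then obtain b where "b \<in> carrier R" "x = b \<otimes> p" unfolding cgenideal_def by blast
    then have "\<zero> \<otimes> r \<oplus> b \<otimes> p = x" using r pc by simp
    then show "x \<in> ?J" using mem[of \<zero> b] \<open>b \<in> carrier R\<close> by fastforce
  qed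
  then have "?J = PIdl p \<or> ?J = carrier R"
    using P.I_maximal[OF J] ideal.Icarr[OF J] by blast
  then show thesis
  proof
    assume "?J = PIdl p"
    moreover have "\<one> \<otimes> r \<oplus> \<zero> \<otimes> p = r" using r pc by simp
    ultimately have "r \<in> PIdl p" using mem[of \<one> \<zero>] by fastforce
    then show thesis using that(1) unfolding cgenideal_def by blast
  next
    assume "?J = carrier R"
    then have "\<one> \<in> ?J" by simp
    then obtain a b where "a \<in> carrier R" "b \<in> carrier R" "\<one> = a \<otimes> r \<oplus> b \<otimes> p"
      unfolding mem_set_add cgenideal_def by blast
    then show thesis using that(2) by metis
  qed
qed

lemma exists_maximalideal:
  assumes I: "ideal I R" and ne: "I \<noteq> carrier R"
  shows "\<exists>J. maximalideal J R \<and> I \<subseteq> J"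
proof -
  \<comment> \<open>Properness is expressed by the absence of 1, a condition that unions of chains
    inherit.\<close>
  let ?S = "{J. ideal J R \<and> I \<subseteq> J \<and> \<one> \<notin> J}"
  have "\<exists>J\<in>?S. \<forall>X\<in>?S. J \<subseteq> X \<longrightarrow> X = J"
  proof (rule subset_Zorn_nonempty)
    show "?S \<noteq> {}" using I ne ideal.one_imp_carrier by blast
    fix C assume C: "C \<noteq> {}" "subset.chain ?S C"
    have id: "ideal J R" if "J \<in> C" for J using C(2) that by (auto simp: subset_chain_def)
    have "ideal (\<Union>C) R"
    proof (rule idealI)
      show "subgroup (\<Union>C) (add_monoid R)"
      proof (rule add.subgroupI)
        show "\<Union>C \<subseteq> carrier R" using ideal.Icarr[OF id] by auto
        show "\<Union>C \<noteq> {}" using C(1) additive_subgroup.zero_closed[OF ideal.axioms(1)[OF id]] by blast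
        fix x assume "x \<in> \<Union>C"
        then show "\<ominus> x \<in> \<Union>C"
          using additive_subgroup.a_inv_closed[OF ideal.axioms(1)[OF id]] by auto
      next
        fix x y assume "x \<in> \<Union>C" "y \<in> \<Union>C"
        then obtain J where "J \<in> C" "x \<in> J" "y \<in> J"
          using C(2) unfolding subset_chain_def by blast
        then show "x \<oplus> y \<in> \<Union>C"
          using additive_subgroup.a_closed[OF ideal.axioms(1)[OF id]] by auto
      qed
    qed (use ring_axioms ideal.I_l_closed[OF id] ideal.I_r_closed[OF id] in blast)+
    then show "\<Union>C \<in> ?S" using C by (auto simp: subset_chain_def)
  qed
  then obtain J where J: "ideal J R" "I \<subseteq> J" "\<one> \<notin> J"
    and J_max: "\<And>X. ideal X R \<Longrightarrow> I \<subseteq> X \<Longrightarrow> \<one> \<notin> X \<Longrightarrow> J \<subseteq> X \<Longrightarrow> X = J" by auto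
  have "maximalideal J R"
  proof (rule maximalidealI[OF J(1)])
    show "carrier R \<noteq> J" using J(3) by auto
    fix X assume X: "ideal X R" "J \<subseteq> X" "X \<subseteq> carrier R"
    show "X = J \<or> X = carrier R"
    proof (cases "\<one> \<in> X")
      case True
      then show ?thesis using ideal.one_imp_carrier[OF X(1)] by simp
    next
      case False
      then show ?thesis using J_max X J(2) by blast
    qed
  qed
  then show ?thesis using J(2) by blast
qed

lemma exists_maximal_generator:
  assumes pir: "principal_ideal_ring R" and I: "ideal I R" "I \<noteq> carrier R"
  shows "\<exists>p. maximal_generator R p \<and> I \<subseteq> PIdl p"
proof -
  obtain J where J: "maximalideal J R" "I \<subseteq> J" using exists_maximalideal[OF I] by blast
  then have "principalideal J R"
    using pir by (auto simp: principal_ideal_ring_def maximalideal_def)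
  then obtain p where "p \<in> carrier R" "J = PIdl p"
    using principalideal.generate cgenideal_eq_genideal by metis
  then show ?thesis using J by (auto simp: maximal_generator_def)
qed

abbreviation list_prod :: "'a list \<Rightarrow> 'a" where
  "list_prod ps \<equiv> foldr (\<otimes>) ps \<one>"

lemma list_prod_closed: "\<forall>p\<in>set ps. maximal_generator R p \<Longrightarrow> list_prod ps \<in> carrier R"
  by (induction ps) (auto simp: maximal_generator_closed)

text \<open>
  If every such product were nonzero, multiplying by a maximal generator above its annihilator
  would always shrink the principal ideal it generates.
\<close>

lemma zero_is_product_of_maximal_generators:
  assumes art: "artinian_ring R" and pir: "principal_ideal_ring R"
  shows "\<exists>ps. (\<forall>p\<in>set ps. maximal_generator R p) \<and> list_prod ps = \<zero>"
proof (rule ccontr)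
  assume neg: "\<not> ?thesis"
  define good where "good ps \<longleftrightarrow> (\<forall>p\<in>set ps. maximal_generator R p)" for ps
  have "\<exists>p. maximal_generator R p \<and> PIdl (list_prod (p # ps)) \<subset> PIdl (list_prod ps)"
    if ps: "good ps" for ps
  proof -
    let ?a = "list_prod ps"
    have a: "?a \<in> carrier R" "?a \<noteq> \<zero>" using neg ps list_prod_closed by (auto simp: good_def)
    let ?I = "{r \<in> carrier R. r \<otimes> ?a = \<zero>}"
    have "ideal ?I R"
    proof (rule idealI)
      show "subgroup ?I (add_monoid R)"
        using a by (intro add.subgroupI) (auto simp: l_distr l_minus intro: exI[of _ \<zero>])
      fix r x assume r: "r \<in> ?I" and x: "x \<in> carrier R"
      then have "(x \<otimes> r) \<otimes> ?a = \<zero>" using a by (simp add: m_assoc)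
      then show "x \<otimes> r \<in> ?I" "r \<otimes> x \<in> ?I" using r x by (auto simp: m_comm)
    qed (rule ring_axioms)
    moreover have "?I \<noteq> carrier R" using a by (metis (mono_tags, lifting) l_one mem_Collect_eq one_closed)
    ultimately obtain p where p: "maximal_generator R p" "?I \<subseteq> PIdl p"
      using exists_maximal_generator[OF pir] by blast
    note pc = maximal_generator_closed[OF p(1)]
    \<comment> \<open>If a = u p a, then 1 - u p annihilates a and so lies in the ideal of
      \<open>p\<close>; but then 1 lies in it too.\<close>
    have "?a \<notin> PIdl (p \<otimes> ?a)"
    proof
      assume "?a \<in> PIdl (p \<otimes> ?a)"
      then obtain u where u: "u \<in> carrier R" "?a = u \<otimes> (p \<otimes> ?a)" unfolding cgenideal_def by blast
      have "(\<one> \<ominus> u \<otimes> p) \<otimes> ?a = ?a \<ominus> u \<otimes> (p \<otimes> ?a)"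
        using a u(1) pc by (simp add: a_minus_def l_distr l_minus m_assoc)
      also have "\<dots> = \<zero>" using a u(2) by (simp add: a_minus_def r_neg)
      finally have "\<one> \<ominus> u \<otimes> p \<in> PIdl p" using p(2) u(1) pc by auto
      then obtain v where v: "v \<in> carrier R" "\<one> \<ominus> u \<otimes> p = v \<otimes> p" unfolding cgenideal_def by blast
      have "\<one> = (\<one> \<ominus> u \<otimes> p) \<oplus> u \<otimes> p" using u(1) pc by (simp add: a_minus_def a_assoc l_neg)
      also have "\<dots> = (v \<oplus> u) \<otimes> p" using v u(1) pc by (simp add: l_distr)
      finally show False using maximal_generator_not_unit[OF p(1), of "v \<oplus> u"] u v by simp
    qed
    moreover have "?a \<in> PIdl ?a" using cgenideal_self a by blast
    moreover have "PIdl (p \<otimes> ?a) \<subseteq> PIdl ?a"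
      using a pc by (auto simp: cgenideal_def m_assoc[symmetric])
    ultimately show ?thesis using p(1) by auto
  qed
  then obtain f where f: "\<And>ps. good ps \<Longrightarrow> maximal_generator R (f ps)"
    "\<And>ps. good ps \<Longrightarrow> PIdl (list_prod (f ps # ps)) \<subset> PIdl (list_prod ps)" by metis
  \<comment> \<open>Prepending a chosen generator again and again yields the strictly descending
    chain of ideals that \<open>art\<close> forbids.\<close>
  define g where "g n = ((\<lambda>ps. f ps # ps) ^^ n) []" for n :: nat
  have g: "good (g n)" for n
    by (induction n) (auto simp: g_def good_def f(1))
  have strict: "PIdl (list_prod (g (Suc n))) \<subset> PIdl (list_prod (g n))" for n
    using f(2)[OF g[of n]] by (simp add: g_def)
  have "ideal (PIdl (list_prod (g n))) R" for n
    using cgenideal_ideal list_prod_closed g by (auto simp: good_def)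
  then have "\<exists>n. \<forall>m\<ge>n. PIdl (list_prod (g m)) = PIdl (list_prod (g n))"
    using art[unfolded artinian_ring_def, rule_format, of "\<lambda>n. PIdl (list_prod (g n))"] strict
    by blast
  then show False using strict by (metis le_SucI order_refl psubset_eq)
qed

text \<open>The ideals of the powers of \<open>p\<close> descend, hence become stationary. The
  relation forces an element of p^n M that \<open>p\<close> kills to be zero, which is where the
  filtration of the p-socle stops.\<close>

lemma artinian_power_stable:
  assumes art: "artinian_ring R" and p: "p \<in> carrier R"
  shows "\<exists>n. \<exists>u\<in>carrier R. p [^] (n::nat) = u \<otimes> p [^] Suc n"
proof -
  have "PIdl (p [^] Suc n) \<subseteq> PIdl (p [^] n)" for n :: nat
  proof
    fix y assume "y \<in> PIdl (p [^] Suc n)"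
    then obtain x where x: "x \<in> carrier R" "y = x \<otimes> p [^] Suc n" unfolding cgenideal_def by blast
    then have "y = (x \<otimes> p) \<otimes> p [^] n" using p by (simp add: m_assoc m_comm[of "p [^] n"])
    then show "y \<in> PIdl (p [^] n)" using x(1) p unfolding cgenideal_def by blast
  qed
  moreover have "ideal (PIdl (p [^] n)) R" for n :: nat
    using cgenideal_ideal p by simp
  ultimately obtain n :: nat where n: "\<forall>m\<ge>n. PIdl (p [^] m) = PIdl (p [^] n)"
    using art[unfolded artinian_ring_def, rule_format, of "\<lambda>n. PIdl (p [^] n)"] by blast
  then have "PIdl (p [^] Suc n) = PIdl (p [^] n)" using le_SucI by blast
  moreover have "p [^] n \<in> PIdl (p [^] n)" using cgenideal_self p by simp
  ultimately have "p [^] n \<in> PIdl (p [^] Suc n)" by simp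
  then show ?thesis unfolding cgenideal_def by blast
qed

end

section \<open>Finiteness conditions and rank functions\<close>

context module
begin

text \<open>The factor of A + R x by \<open>A\<close> is cyclic and killed by \<open>p\<close>,
  hence zero or simple. Concretely, an element a + r x outside \<open>A\<close> has \<open>r\<close>
  invertible modulo \<open>p\<close>, and then \<open>x\<close> can be recovered from it.\<close>

lemma ranked_simple_step:
  assumes p: "maximal_generator R p" and A: "submodule A R M"
    and x: "x \<in> carrier M" and px: "p \<odot>\<^bsub>M\<^esub> x \<in> A"
  shows "ranked R M A (A <+>\<^bsub>M\<^esub> cyclic_submodule R M x)"
proof (rule ranked_cover)
  note pc = maximal_generator_closed[OF p]
  fix H assume H: "submodule H R M" "A \<subset> H" "H \<subset> A <+>\<^bsub>M\<^esub> cyclic_submodule R M x"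
  then obtain h where h: "h \<in> H" "h \<notin> A" by auto
  have "h \<in> A <+>\<^bsub>M\<^esub> cyclic_submodule R M x" using H(3) h(1) by blast
  then obtain a r where ar: "a \<in> A" "r \<in> carrier R" "h = a \<oplus>\<^bsub>M\<^esub> r \<odot>\<^bsub>M\<^esub> x"
    unfolding mem_set_add cyclic_submodule_def by blast
  from p ar(2) have "x \<in> H"
  proof (cases rule: maximal_generator_cases)
    case (1 s)
    then have "r \<odot>\<^bsub>M\<^esub> x = s \<odot>\<^bsub>M\<^esub> (p \<odot>\<^bsub>M\<^esub> x)" using x pc by (simp add: smult_assoc1)
    then have "h \<in> A" using ar px 1 submodule_smult[OF A] submodule_add[OF A] by simp
    then show ?thesis using h by simp
  next
    case (2 u b)
    have "h \<ominus>\<^bsub>M\<^esub> a \<in> H" using h ar H submodule_minus by blast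
    moreover have "h \<ominus>\<^bsub>M\<^esub> a = r \<odot>\<^bsub>M\<^esub> x"
      using ar x submodule_carrier[OF A] by (simp add: minus_add_cancel M.a_comm[of a])
    ultimately have rx: "r \<odot>\<^bsub>M\<^esub> x \<in> H" by simp
    have "x = (u \<otimes> r \<oplus> b \<otimes> p) \<odot>\<^bsub>M\<^esub> x" using 2 x by simp
    also have "\<dots> = u \<odot>\<^bsub>M\<^esub> (r \<odot>\<^bsub>M\<^esub> x) \<oplus>\<^bsub>M\<^esub> b \<odot>\<^bsub>M\<^esub> (p \<odot>\<^bsub>M\<^esub> x)"
      using 2(1,2) x pc ar(2) by (simp add: smult_l_distr smult_assoc1)
    finally have e: "x = u \<odot>\<^bsub>M\<^esub> (r \<odot>\<^bsub>M\<^esub> x) \<oplus>\<^bsub>M\<^esub> b \<odot>\<^bsub>M\<^esub> (p \<odot>\<^bsub>M\<^esub> x)" .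
    have "p \<odot>\<^bsub>M\<^esub> x \<in> H" using px H(2) by blast
    then have "u \<odot>\<^bsub>M\<^esub> (r \<odot>\<^bsub>M\<^esub> x) \<oplus>\<^bsub>M\<^esub> b \<odot>\<^bsub>M\<^esub> (p \<odot>\<^bsub>M\<^esub> x) \<in> H"
      using rx 2(1,2) by (simp add: submodule_add[OF H(1)] submodule_smult[OF H(1)])
    then show ?thesis by (simp only: e[symmetric])
  qed
  then have "A <+>\<^bsub>M\<^esub> cyclic_submodule R M x \<subseteq> H"
    using set_add_least[OF H(1)] cyclic_least[OF H(1)] H(2) by blast
  then show False using H by auto
qed

text \<open>Modulo \<open>A\<close>, the element p x is killed by the product of the remaining
  factors, so induction reaches A + R p x. The last step, up to \<open>x\<close>, is killed by
  \<open>p\<close> and hence at most simple.\<close>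

lemma ranked_add_cyclic:
  assumes "\<forall>p\<in>set ps. maximal_generator R p" and A: "submodule A R M"
    and "x \<in> carrier M" "list_prod ps \<odot>\<^bsub>M\<^esub> x \<in> A"
  shows "ranked R M A (A <+>\<^bsub>M\<^esub> cyclic_submodule R M x)"
  using assms(1,3,4)
proof (induction ps arbitrary: x)
  case Nil
  then have "A <+>\<^bsub>M\<^esub> cyclic_submodule R M x \<subseteq> A"
    using set_add_least[OF A] cyclic_least[OF A] by simp
  then show ?case using ranked_mono[OF ranked_refl] by blast
next
  case (Cons p ps)
  then have p: "maximal_generator R p" "p \<in> carrier R" and Q: "list_prod ps \<in> carrier R"
    by (auto simp: maximal_generator_closed intro!: list_prod_closed)
  let ?A = "A <+>\<^bsub>M\<^esub> cyclic_submodule R M (p \<odot>\<^bsub>M\<^esub> x)"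
  have px: "p \<odot>\<^bsub>M\<^esub> x \<in> carrier M" using p Cons.prems by simp
  have A': "submodule ?A R M" by (intro submodule_set_add A submodule_cyclic px)
  have "list_prod ps \<odot>\<^bsub>M\<^esub> (p \<odot>\<^bsub>M\<^esub> x) \<in> A"
    using Cons.prems p Q by (simp add: smult_assoc1 smult_commute[of _ p])
  then have 1: "ranked R M A ?A" using Cons.IH[OF _ px] Cons.prems by simp
  have pxA: "p \<odot>\<^bsub>M\<^esub> x \<in> ?A"
    using cyclic_self[OF px] set_add_upper(2)[OF A submodule_cyclic[OF px]] by blast
  have 2: "ranked R M ?A (?A <+>\<^bsub>M\<^esub> cyclic_submodule R M x)"
    by (rule ranked_simple_step[OF p(1) A' Cons.prems(2) pxA])
  have sub: "A \<subseteq> ?A" "?A \<subseteq> ?A <+>\<^bsub>M\<^esub> cyclic_submodule R M x"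
    using set_add_upper A A' submodule_cyclic px Cons.prems(2) by blast+
  have "ranked R M A (?A <+>\<^bsub>M\<^esub> cyclic_submodule R M x)"
    by (rule ranked_trans[OF A' 1 2 sub]) (intro submodule_set_add A' submodule_cyclic Cons.prems(2))
  moreover have "A <+>\<^bsub>M\<^esub> cyclic_submodule R M x \<subseteq> ?A <+>\<^bsub>M\<^esub> cyclic_submodule R M x"
    using set_add_mono_left[OF sub(1)] .
  ultimately show ?case using ranked_mono by blast
qed

text \<open>Partial products interpolate between the kernel of 1, which is zero, and the kernel of
  0, which is all of \<open>M\<close>; each further factor \<open>p\<close> costs one
  p-socle.\<close>

lemma ranked_if_socles_ranked:
  assumes art: "artinian_ring R" and pir: "principal_ideal_ring R"
    and soc: "\<And>p. maximal_generator R p \<Longrightarrow> ranked R M {\<zero>\<^bsub>M\<^esub>} (scalar_kernel R M p)"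
  shows "ranked R M {\<zero>\<^bsub>M\<^esub>} (carrier M)"
proof -
  obtain qs where qs: "\<forall>p\<in>set qs. maximal_generator R p" "list_prod qs = \<zero>"
    using zero_is_product_of_maximal_generators[OF art pir] by blast
  have "ranked R M {\<zero>\<^bsub>M\<^esub>} (scalar_kernel R M (list_prod ps))"
    if "\<forall>p\<in>set ps. maximal_generator R p" for ps
    using that
  proof (induction ps)
    case Nil
    have "scalar_kernel R M \<one> \<subseteq> {\<zero>\<^bsub>M\<^esub>}" by (auto simp: scalar_kernel_def)
    then show ?case using ranked_mono[OF ranked_refl] by simp
  next
    case (Cons p ps)
    have p: "p \<in> carrier R" and Q: "list_prod ps \<in> carrier R"
      using Cons.prems by (auto simp: maximal_generator_closed intro!: list_prod_closed)
    have "ranked R M {\<zero>\<^bsub>M\<^esub>} (scalar_kernel R M (list_prod ps \<otimes> p))"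
      by (rule ranked_scalar_kernel[OF Q p]) (use Cons soc in auto)
    then show ?case using p Q by (simp add: R.m_comm)
  qed
  from this[OF qs(1)] qs(2) have "ranked R M {\<zero>\<^bsub>M\<^esub>} (scalar_kernel R M \<zero>)" by simp
  moreover have "carrier M \<subseteq> scalar_kernel R M \<zero>" by (auto simp: scalar_kernel_def)
  ultimately show ?thesis using ranked_mono by blast
qed

text \<open>The ranks along an ascending chain are bounded by the rank of the whole module, and the
  chain is constant from a term of largest rank on.\<close>

lemma ranked_imp_noetherian:
  assumes "ranked R M {\<zero>\<^bsub>M\<^esub>} (carrier M)"
  shows "noetherian_module R M"
  unfolding noetherian_module_def
proof (intro allI impI, elim conjE)
  obtain d where d: "\<And>H K. submodule H R M \<Longrightarrow> submodule K R M \<Longrightarrow> {\<zero>\<^bsub>M\<^esub>} \<subseteq> H \<Longrightarrow> H \<subset> K \<Longrightarrow> K \<subseteq> carrier M \<Longrightarrow> d H < d K"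
    "\<And>H K. submodule H R M \<Longrightarrow> submodule K R M \<Longrightarrow> {\<zero>\<^bsub>M\<^esub>} \<subseteq> H \<Longrightarrow> H \<subseteq> K \<Longrightarrow> K \<subseteq> carrier M \<Longrightarrow> d H \<le> (d K :: nat)"
    by (rule rankedE[OF assms], rule that)
  fix N :: "nat \<Rightarrow> _" assume N: "\<forall>n. submodule (N n) R M" and inc: "\<forall>n. N n \<subseteq> N (Suc n)"
  have N': "{\<zero>\<^bsub>M\<^esub>} \<subseteq> N n" "N n \<subseteq> carrier M" for n
    using N submodule_zero submodule_carrier by blast+
  have "\<forall>n. d (N n) < Suc (d (carrier M))"
    using d(2)[OF _ carrier_is_submodule] N N' by (simp add: less_Suc_eq_le)
  then obtain n where n: "\<forall>m. d (N m) \<le> d (N n)"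
    using ex_has_greatest_nat[of "\<lambda>_. True" _ "\<lambda>n. d (N n)"] by blast
  have "N m = N n" if "n \<le> m" for m
  proof (rule ccontr)
    assume "N m \<noteq> N n"
    moreover have "N n \<subseteq> N m" using lift_Suc_mono_le[of N, OF _ that] inc by simp
    ultimately have "N n \<subset> N m" by blast
    then have "d (N n) < d (N m)" using d(1)[of "N n" "N m"] N N' by simp
    then show False using n by (simp add: leD)
  qed
  then show "\<exists>n. \<forall>m\<ge>n. N m = N n" by blast
qed

lemma ranked_imp_artinian:
  assumes "ranked R M {\<zero>\<^bsub>M\<^esub>} (carrier M)"
  shows "artinian_module R M"
  unfolding artinian_module_def
proof (intro allI impI, elim conjE)
  obtain d where d: "\<And>H K. submodule H R M \<Longrightarrow> submodule K R M \<Longrightarrow> {\<zero>\<^bsub>M\<^esub>} \<subseteq> H \<Longrightarrow> H \<subset> K \<Longrightarrow> K \<subseteq> carrier M \<Longrightarrow> d H < (d K :: nat)"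
    by (rule rankedE[OF assms], rule that)
  fix N :: "nat \<Rightarrow> _" assume N: "\<forall>n. submodule (N n) R M" and dec: "\<forall>n. N (Suc n) \<subseteq> N n"
  have N': "{\<zero>\<^bsub>M\<^esub>} \<subseteq> N n" "N n \<subseteq> carrier M" for n
    using N submodule_zero submodule_carrier by blast+
  obtain n where n: "\<forall>m. d (N n) \<le> d (N m)"
    using ex_has_least_nat[of "\<lambda>_. True" _ "\<lambda>n. d (N n)"] by blast
  have "N m = N n" if "n \<le> m" for m
  proof (rule ccontr)
    assume "N m \<noteq> N n"
    moreover have "N m \<subseteq> N n" using lift_Suc_antimono_le[of N, OF _ that] dec by simp
    ultimately have "N m \<subset> N n" by blast
    then have "d (N m) < d (N n)" using d(1)[of "N m" "N n"] N N' by simp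
    then show False using n by (simp add: leD)
  qed
  then show "\<exists>n. \<forall>m\<ge>n. N m = N n" by blast
qed

end

section \<open>Composition series\<close>

context module
begin

text \<open>Induction on the rank of the top term \<open>K\<close>: among the proper submodules of
  \<open>K\<close>, one of largest rank is maximal, and its own series is prolonged by
  \<open>K\<close>.\<close>

lemma ranked_imp_finite_length:
  assumes "ranked R M {\<zero>\<^bsub>M\<^esub>} (carrier M)"
  shows "finite_length R M"
proof -
  obtain d where d: "\<And>H K. submodule H R M \<Longrightarrow> submodule K R M \<Longrightarrow> {\<zero>\<^bsub>M\<^esub>} \<subseteq> H \<Longrightarrow> H \<subset> K \<Longrightarrow> K \<subseteq> carrier M \<Longrightarrow> d H < (d K :: nat)"
    "\<And>H K. submodule H R M \<Longrightarrow> submodule K R M \<Longrightarrow> {\<zero>\<^bsub>M\<^esub>} \<subseteq> H \<Longrightarrow> H \<subseteq> K \<Longrightarrow> K \<subseteq> carrier M \<Longrightarrow> d H \<le> (d K :: nat)"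
    by (rule rankedE[OF assms], rule that)
  have d': "d H < d K" if "submodule H R M" "submodule K R M" "H \<subset> K" for H K
    using d(1) that submodule_zero submodule_carrier by (meson empty_subsetI insert_subset subsetI)
  have "\<exists>n N. N 0 = {\<zero>\<^bsub>M\<^esub>} \<and> N n = K \<and> (\<forall>k\<le>n. submodule (N k) R M) \<and>
      (\<forall>k<n. N k \<subset> N (Suc k) \<and> \<not> (\<exists>H. submodule H R M \<and> N k \<subset> H \<and> H \<subset> N (Suc k)))"
    if "submodule K R M" for K
    using that
  proof (induction "d K" arbitrary: K rule: less_induct)
    case less
    show ?case
    proof (cases "K = {\<zero>\<^bsub>M\<^esub>}")
      case True
      then show ?thesis using submodule_trivial
        by (intro exI[of _ "0::nat"] exI[of _ "\<lambda>_. K"]) auto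
    next
      case False
      let ?P = "\<lambda>H. submodule H R M \<and> H \<subset> K"
      have P0: "?P {\<zero>\<^bsub>M\<^esub>}" using False less.prems submodule_trivial submodule_zero by auto
      have "\<exists>H. ?P H \<and> (\<forall>H'. ?P H' \<longrightarrow> d H' \<le> d H)"
        using ex_has_greatest_nat[of ?P "{\<zero>\<^bsub>M\<^esub>}" d "Suc (d K)"] P0 d' less.prems
        by (meson less_Suc_eq less_imp_le)
      then obtain H where H: "?P H" and H_max: "\<And>H'. ?P H' \<Longrightarrow> d H' \<le> d H" by blast
      obtain n N where N: "N 0 = {\<zero>\<^bsub>M\<^esub>}" "N n = H" "\<And>k. k \<le> n \<Longrightarrow> submodule (N k) R M"
        "\<And>k. k < n \<Longrightarrow> N k \<subset> N (Suc k) \<and> \<not> (\<exists>H. submodule H R M \<and> N k \<subset> H \<and> H \<subset> N (Suc k))"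
        using less.hyps[of H] d'[of H K] H less.prems by blast
      have max: "\<not> (\<exists>H'. submodule H' R M \<and> H \<subset> H' \<and> H' \<subset> K)"
        using H_max d'[of H] H by (meson leD)
      let ?N = "N(Suc n := K)"
      have "?N k \<subset> ?N (Suc k) \<and> \<not> (\<exists>H. submodule H R M \<and> ?N k \<subset> H \<and> H \<subset> ?N (Suc k))"
        if "k < Suc n" for k
      proof (cases "k = n")
        case True then show ?thesis using N(2) H max by simp
      next
        case False then show ?thesis using N(4)[of k] that by simp
      qed
      then show ?thesis using N(1,3) less.prems
        by (intro exI[of _ "Suc n"] exI[of _ ?N]) (simp add: le_Suc_eq)
    qed
  qed
  then show ?thesis unfolding finite_length_def using carrier_is_submodule by blast
qed

lemma finite_length_imp_ranked:
  assumes "finite_length R M"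
  shows "ranked R M {\<zero>\<^bsub>M\<^esub>} (carrier M)"
proof -
  obtain n N where N': "N 0 = {\<zero>\<^bsub>M\<^esub>} \<and> N n = carrier M \<and> (\<forall>k\<le>n. submodule (N k) R M) \<and>
      (\<forall>k<n. N k \<subset> N (Suc k) \<and> \<not> (\<exists>H. submodule H R M \<and> N k \<subset> H \<and> H \<subset> N (Suc k)))"
    using assms unfolding finite_length_def by (elim exE)
  then have N: "N 0 = {\<zero>\<^bsub>M\<^esub>}" "N n = carrier M" "\<And>k. k \<le> n \<Longrightarrow> submodule (N k) R M"
    "\<And>k. k < n \<Longrightarrow> N k \<subset> N (Suc k)"
    by simp_all
  have cover: False if "k < n" "submodule H R M" "N k \<subset> H" "H \<subset> N (Suc k)" for k H
    using N' that by blast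
  have "ranked R M {\<zero>\<^bsub>M\<^esub>} (N k)" if "k \<le> n" for k
    using that
  proof (induction k)
    case 0
    then show ?case using N(1) ranked_refl by simp
  next
    case (Suc k)
    have "ranked R M (N k) (N (Suc k))"
      by (rule ranked_cover, rule cover[of k]) (use Suc.prems in simp_all)
    then show ?case
      using ranked_trans[of "N k" "{\<zero>\<^bsub>M\<^esub>}" "N (Suc k)"] N(3)[of k] N(3)[of "Suc k"] N(4)[of k] Suc
        submodule_zero by auto
  qed
  then show ?thesis using N(2) by (metis order_refl)
qed

section \<open>Finite generation\<close>

definition linear_combinations :: "'c set \<Rightarrow> 'c set" where
  "linear_combinations A = {\<Oplus>\<^bsub>M\<^esub>a\<in>A. c a \<odot>\<^bsub>M\<^esub> a |c. c \<in> A \<rightarrow> carrier R}"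

lemma linear_combinations_insert:
  assumes A: "finite A" "A \<subseteq> carrier M" and x: "x \<in> carrier M" "x \<notin> A"
  shows "linear_combinations (insert x A) = linear_combinations A <+>\<^bsub>M\<^esub> cyclic_submodule R M x"
proof -
  have sum: "(\<Oplus>\<^bsub>M\<^esub>a\<in>insert x A. c a \<odot>\<^bsub>M\<^esub> a) = (\<Oplus>\<^bsub>M\<^esub>a\<in>A. c a \<odot>\<^bsub>M\<^esub> a) \<oplus>\<^bsub>M\<^esub> c x \<odot>\<^bsub>M\<^esub> x"
    if "c \<in> insert x A \<rightarrow> carrier R" for c
  proof -
    have f: "(\<lambda>a. c a \<odot>\<^bsub>M\<^esub> a) \<in> A \<rightarrow> carrier M" "c x \<odot>\<^bsub>M\<^esub> x \<in> carrier M" using that A x by auto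
    then show ?thesis using M.finsum_insert[OF A(1) x(2) f] M.finsum_closed[OF f(1)]
      by (simp add: M.a_comm)
  qed
  show ?thesis
  proof
    show "linear_combinations (insert x A) \<subseteq> linear_combinations A <+>\<^bsub>M\<^esub> cyclic_submodule R M x"
    proof
      fix z assume "z \<in> linear_combinations (insert x A)"
      then obtain c where c: "c \<in> insert x A \<rightarrow> carrier R" "z = (\<Oplus>\<^bsub>M\<^esub>a\<in>insert x A. c a \<odot>\<^bsub>M\<^esub> a)"
        unfolding linear_combinations_def by blast
      have "(\<Oplus>\<^bsub>M\<^esub>a\<in>A. c a \<odot>\<^bsub>M\<^esub> a) \<in> linear_combinations A" "c x \<odot>\<^bsub>M\<^esub> x \<in> cyclic_submodule R M x"
        using c(1) by (auto simp: linear_combinations_def cyclic_submodule_def)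
      then show "z \<in> linear_combinations A <+>\<^bsub>M\<^esub> cyclic_submodule R M x"
        unfolding mem_set_add using c(2) sum[OF c(1)] by blast
    qed
    show "linear_combinations A <+>\<^bsub>M\<^esub> cyclic_submodule R M x \<subseteq> linear_combinations (insert x A)"
    proof
      fix z assume "z \<in> linear_combinations A <+>\<^bsub>M\<^esub> cyclic_submodule R M x"
      then obtain y w where yw: "y \<in> linear_combinations A" "w \<in> cyclic_submodule R M x" "z = y \<oplus>\<^bsub>M\<^esub> w"
        unfolding mem_set_add by blast
      obtain c where c: "c \<in> A \<rightarrow> carrier R" "y = (\<Oplus>\<^bsub>M\<^esub>a\<in>A. c a \<odot>\<^bsub>M\<^esub> a)"
        using yw(1) unfolding linear_combinations_def by blast
      obtain r where r: "r \<in> carrier R" "w = r \<odot>\<^bsub>M\<^esub> x"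
        using yw(2) unfolding cyclic_submodule_def by blast
      let ?c = "c(x := r)"
      have c': "?c \<in> insert x A \<rightarrow> carrier R" using c r by auto
      have "(\<Oplus>\<^bsub>M\<^esub>a\<in>A. ?c a \<odot>\<^bsub>M\<^esub> a) = y"
        unfolding c(2) using c(1) A x by (intro M.finsum_cong') auto
      then have "z = (\<Oplus>\<^bsub>M\<^esub>a\<in>insert x A. ?c a \<odot>\<^bsub>M\<^esub> a)" using sum[OF c'] r yw(3) by simp
      then show "z \<in> linear_combinations (insert x A)" using c' unfolding linear_combinations_def by blast
    qed
  qed
qed

lemma linear_combinations_submodule:
  assumes "finite A" "A \<subseteq> carrier M"
  shows "submodule (linear_combinations A) R M \<and> A \<subseteq> linear_combinations A"
  using assms
proof (induction A rule: finite_induct)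
  case empty
  then show ?case using submodule_trivial by (auto simp: linear_combinations_def)
next
  case (insert x A)
  then have A: "submodule (linear_combinations A) R M" "A \<subseteq> linear_combinations A"
    and x: "x \<in> carrier M" by auto
  have "A \<subseteq> linear_combinations A <+>\<^bsub>M\<^esub> cyclic_submodule R M x"
    "x \<in> linear_combinations A <+>\<^bsub>M\<^esub> cyclic_submodule R M x"
    using set_add_upper[OF A(1) submodule_cyclic[OF x]] A(2) cyclic_self[OF x] by blast+
  then show ?case
    using linear_combinations_insert[of A x] insert submodule_set_add[OF A(1) submodule_cyclic[OF x]]
    by simp
qed

lemma finitely_generated_iff:
  "finitely_generated R M \<longleftrightarrow> (\<exists>A. finite A \<and> A \<subseteq> carrier M \<and> linear_combinations A = carrier M)"
proof -
  have "(\<forall>x\<in>carrier M. \<exists>c\<in>A \<rightarrow> carrier R. x = (\<Oplus>\<^bsub>M\<^esub>a\<in>A. c a \<odot>\<^bsub>M\<^esub> a)) \<longleftrightarrow>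
      linear_combinations A = carrier M" (is "?l \<longleftrightarrow> ?r")
    if "finite A" "A \<subseteq> carrier M" for A
  proof -
    have "linear_combinations A \<subseteq> carrier M"
      using linear_combinations_submodule[OF that] submodule_carrier by blast
    moreover have "?l \<longleftrightarrow> carrier M \<subseteq> linear_combinations A"
      unfolding linear_combinations_def by blast
    ultimately show ?thesis by blast
  qed
  then show ?thesis unfolding finitely_generated_def by blast
qed

text \<open>A finite set whose span has the largest possible rank must generate, since an element
  outside the span could be added to give a larger rank.\<close>

lemma ranked_imp_finitely_generated:
  assumes "ranked R M {\<zero>\<^bsub>M\<^esub>} (carrier M)"
  shows "finitely_generated R M"
proof -
  obtain d where d: "\<And>H K. submodule H R M \<Longrightarrow> submodule K R M \<Longrightarrow> {\<zero>\<^bsub>M\<^esub>} \<subseteq> H \<Longrightarrow> H \<subset> K \<Longrightarrow> K \<subseteq> carrier M \<Longrightarrow> d H < d K"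
    "\<And>H K. submodule H R M \<Longrightarrow> submodule K R M \<Longrightarrow> {\<zero>\<^bsub>M\<^esub>} \<subseteq> H \<Longrightarrow> H \<subseteq> K \<Longrightarrow> K \<subseteq> carrier M \<Longrightarrow> d H \<le> (d K :: nat)"
    by (rule rankedE[OF assms], rule that)
  let ?P = "\<lambda>A. finite A \<and> A \<subseteq> carrier M"
  let ?L = linear_combinations
  have L: "submodule (?L A) R M" "A \<subseteq> ?L A" "{\<zero>\<^bsub>M\<^esub>} \<subseteq> ?L A" "?L A \<subseteq> carrier M" if "?P A" for A
    using linear_combinations_submodule[of A] that submodule_zero[of "?L A"]
      submodule_carrier[of "?L A"] by auto
  have "\<forall>A. ?P A \<longrightarrow> d (?L A) < Suc (d (carrier M))"
    using d(2)[OF L(1) carrier_is_submodule L(3,4)] by (simp add: less_Suc_eq_le)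
  then have "\<exists>A. ?P A \<and> (\<forall>B. ?P B \<longrightarrow> d (?L B) \<le> d (?L A))"
    by (rule ex_has_greatest_nat[where k = "{}", rotated]) simp
  then obtain A where A: "?P A" "\<And>B. ?P B \<Longrightarrow> d (?L B) \<le> d (?L A)" by blast
  have "carrier M \<subseteq> ?L A"
  proof (rule subsetI, rule ccontr)
    fix x assume x: "x \<in> carrier M" "x \<notin> ?L A"
    then have "x \<notin> A" using L(2)[OF A(1)] by blast
    then have eq: "?L (insert x A) = ?L A <+>\<^bsub>M\<^esub> cyclic_submodule R M x"
      using linear_combinations_insert x A(1) by simp
    have B: "?P (insert x A)" using A(1) x by simp
    have "?L A \<subset> ?L (insert x A)"
      using set_add_upper(1)[OF L(1)[OF A(1)] submodule_cyclic[OF x(1)]] L(2)[OF B] x(2)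
      unfolding eq by blast
    then have "d (?L A) < d (?L (insert x A))"
      by (intro d(1) L A(1) B)
    then show False using A(2)[OF B] by simp
  qed
  then show ?thesis unfolding finitely_generated_iff using A(1) L(4) by blast
qed

text \<open>Zero is a product of maximal generators, so such a product kills every element, and by
  \<open>ranked_add_cyclic\<close> each generator of the module adds a ranked interval.\<close>

lemma finitely_generated_imp_ranked:
  assumes art: "artinian_ring R" and pir: "principal_ideal_ring R" and "finitely_generated R M"
  shows "ranked R M {\<zero>\<^bsub>M\<^esub>} (carrier M)"
proof -
  obtain ps where ps: "\<forall>p\<in>set ps. maximal_generator R p" "list_prod ps = \<zero>"
    using zero_is_product_of_maximal_generators[OF art pir] by blast
  have "ranked R M {\<zero>\<^bsub>M\<^esub>} (linear_combinations A)" if "finite A" "A \<subseteq> carrier M" for A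
    using that
  proof (induction A rule: finite_induct)
    case empty
    have "linear_combinations {} \<subseteq> {\<zero>\<^bsub>M\<^esub>}" by (auto simp: linear_combinations_def)
    then show ?case using ranked_mono[OF ranked_refl] by blast
  next
    case (insert x A)
    then have A: "submodule (linear_combinations A) R M" and x: "x \<in> carrier M"
      using linear_combinations_submodule[of A] by auto
    have "list_prod ps \<odot>\<^bsub>M\<^esub> x \<in> linear_combinations A"
      using ps(2) x submodule_zero[OF A] by simp
    then have "ranked R M (linear_combinations A) (linear_combinations (insert x A))"
      using ranked_add_cyclic[OF ps(1) A x] linear_combinations_insert[of A x] insert by simp
    moreover have "linear_combinations A \<subseteq> linear_combinations (insert x A)"
      using linear_combinations_insert[of A x] insert set_add_upper(1)[OF A submodule_cyclic[OF x]]
      by simp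
    moreover have "submodule (linear_combinations (insert x A)) R M"
      using linear_combinations_submodule[of "insert x A"] insert by simp
    ultimately show ?case
      using ranked_trans[OF A, of "{\<zero>\<^bsub>M\<^esub>}"] insert submodule_zero[OF A] by blast
  qed
  then show ?thesis using assms(3) unfolding finitely_generated_iff by metis
qed

text \<open>The kernels of the powers of \<open>f\<close> ascend. Once those of
  \<open>f ^^ n\<close> and \<open>f ^^ Suc n\<close> agree, an element of the kernel of
  \<open>f\<close>, written as \<open>(f ^^ n) y\<close> by surjectivity, is zero: \<open>y\<close>
  lies in the second kernel, hence in the first.\<close>

lemma noetherian_imp_hopfian:
  assumes "noetherian_module R M"
  shows "hopfian R M"
  unfolding hopfian_def
proof (intro ballI impI)
  fix f assume f: "f \<in> mod_hom R M M" and surj: "f ` carrier M = carrier M"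
  note MM = module_axioms module_axioms
  \<comment> \<open>Membership in the zero submodule replaces an equation, so that
    \<open>mod_hom_vimage\<close> applies.\<close>
  define N where "N n = {x \<in> carrier M. (f ^^ n) x \<in> {\<zero>\<^bsub>M\<^esub>}}" for n
  have "\<forall>n. submodule (N n) R M"
    unfolding N_def by (intro allI mod_hom_vimage[OF MM mod_hom_funpow[OF f]] submodule_trivial)
  moreover have "\<forall>n. N n \<subseteq> N (Suc n)" using mod_hom_zero[OF MM f] by (auto simp: N_def)
  ultimately obtain n where "\<forall>m\<ge>n. N m = N n"
    using assms[unfolded noetherian_module_def, rule_format, of N] by metis
  then have n: "N (Suc n) = N n" using le_SucI[OF order_refl] by blast
  have surj_n: "(f ^^ n) ` carrier M = carrier M"
    by (induction n) (simp, metis funpow.simps(2) image_comp surj)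
  have "inj_on f (carrier M)"
  proof (rule mod_hom_inj_onI[OF MM f])
    fix x assume x: "x \<in> carrier M" "f x = \<zero>\<^bsub>M\<^esub>"
    obtain y where y: "y \<in> carrier M" "x = (f ^^ n) y" using x(1) surj_n by blast
    then have "y \<in> N n" using x n by (auto simp: N_def)
    then show "x = \<zero>\<^bsub>M\<^esub>" using y by (simp add: N_def)
  qed
  then show "f \<in> mod_iso R M M" using f surj by (simp add: mod_iso_def bij_betw_def)
qed

text \<open>Dually, the images of the powers descend. Once those of \<open>f ^^ n\<close> and
  \<open>f ^^ Suc n\<close> agree, each \<open>(f ^^ n) x\<close> equals some
  \<open>(f ^^ n) (f y)\<close>, and the injective power cancels.\<close>

lemma artinian_imp_co_hopfian:
  assumes "artinian_module R M"
  shows "co_hopfian R M"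
  unfolding co_hopfian_def
proof (intro ballI impI)
  fix f assume f: "f \<in> mod_hom R M M" and inj: "inj_on f (carrier M)"
  note MM = module_axioms module_axioms
  note fn = mod_hom_funpow[OF f]
  note fc = mod_homD(1)[OF f]
  define N where "N n = (f ^^ n) ` carrier M" for n
  have "\<forall>n. submodule (N n) R M"
    unfolding N_def by (intro allI mod_hom_image[OF MM fn] carrier_is_submodule)
  moreover have "\<forall>n. N (Suc n) \<subseteq> N n" using fc by (auto simp: N_def funpow_swap1)
  ultimately obtain n where "\<forall>m\<ge>n. N m = N n"
    using assms[unfolded artinian_module_def, rule_format, of N] by metis
  then have n: "N (Suc n) = N n" using le_SucI[OF order_refl] by blast
  have inj_n: "inj_on (f ^^ n) (carrier M)" for n
  proof (induction n)
    case (Suc n)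
    then show ?case
      using inj mod_homD(1)[OF fn[of n]] by (auto simp: inj_on_def)
  qed simp
  have "carrier M \<subseteq> f ` carrier M"
  proof
    fix x assume x: "x \<in> carrier M"
    then have "(f ^^ n) x \<in> N (Suc n)" unfolding n by (simp add: N_def)
    then obtain y where y: "y \<in> carrier M" "(f ^^ n) x = (f ^^ n) (f y)"
      by (auto simp: N_def funpow_swap1)
    then have "x = f y" using inj_onD[OF inj_n] x fc by blast
    then show "x \<in> f ` carrier M" using y by blast
  qed
  then show "f \<in> mod_iso R M M" using f inj fc by (auto simp: mod_iso_def bij_betw_def)
qed

end

section \<open>Splitting off an infinite homocyclic summand\<close>

context module
begin

text \<open>A relative of the theorem that a bounded pure subgroup is a direct summand:
  \<open>N_inter\<close> makes p^(k+1) kill \<open>N\<close> and keeps nonzero elements of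
  \<open>N\<close> from being too divisible in \<open>M\<close>, while \<open>N_div\<close> supplies
  divisibility inside \<open>N\<close>.\<close>

lemma exists_complement:
  assumes p: "maximal_generator R p" and N: "submodule N R M"
    and N_inter: "N \<inter> scalar_image M (p [^] Suc k) (carrier M) \<subseteq> {\<zero>\<^bsub>M\<^esub>}"
    and N_div: "\<And>w. w \<in> N \<Longrightarrow> p [^] k \<odot>\<^bsub>M\<^esub> w = \<zero>\<^bsub>M\<^esub> \<Longrightarrow> \<exists>z\<in>N. w = p \<odot>\<^bsub>M\<^esub> z"
  shows "\<exists>C. submodule C R M \<and> N \<inter> C \<subseteq> {\<zero>\<^bsub>M\<^esub>} \<and> N <+>\<^bsub>M\<^esub> C = carrier M"
proof -
  note pc = maximal_generator_closed[OF p]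
  define D where "D = scalar_image M (p [^] Suc k) (carrier M)"
  have D: "submodule D R M"
    unfolding D_def using pc by (intro submodule_scalar_image carrier_is_submodule) simp
  \<comment> \<open>With p^(k+1) M inside every candidate, p^(k+1) kills everything modulo
    \<open>C\<close>. Reaching all of \<open>M\<close> then only takes the passage from p x to
    x.\<close>
  let ?S = "{C. submodule C R M \<and> D \<subseteq> C \<and> N \<inter> C \<subseteq> {\<zero>\<^bsub>M\<^esub>}}"
  have "\<exists>C\<in>?S. \<forall>X\<in>?S. C \<subseteq> X \<longrightarrow> X = C"
  proof (rule subset_Zorn_nonempty)
    show "?S \<noteq> {}" using D N_inter D_def by blast
    fix C assume C: "C \<noteq> {}" "subset.chain ?S C"
    have sub: "submodule X R M" "D \<subseteq> X" "N \<inter> X \<subseteq> {\<zero>\<^bsub>M\<^esub>}" if "X \<in> C" for X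
      using C(2) that unfolding subset_chain_def by blast+
    have "submodule (\<Union>C) R M"
    proof (rule submoduleI')
      show "\<Union>C \<subseteq> carrier M" using submodule_carrier[OF sub(1)] by blast
      show "\<zero>\<^bsub>M\<^esub> \<in> \<Union>C" using submodule_zero[OF sub(1)] C(1) by blast
      fix x y assume "x \<in> \<Union>C" "y \<in> \<Union>C"
      then obtain X Y where XY: "X \<in> C" "Y \<in> C" "x \<in> X" "y \<in> Y" by blast
      have "X \<subseteq> Y \<or> Y \<subseteq> X" using C(2) XY(1,2) unfolding subset_chain_def by blast
      then show "x \<oplus>\<^bsub>M\<^esub> y \<in> \<Union>C"
      proof
        assume "X \<subseteq> Y"
        then show ?thesis using submodule_add[OF sub(1)[OF XY(2)], of x y] XY by blast
      next
        assume "Y \<subseteq> X"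
        then show ?thesis using submodule_add[OF sub(1)[OF XY(1)], of x y] XY by blast
      qed
    next
      fix r x assume "r \<in> carrier R" "x \<in> \<Union>C"
      then show "r \<odot>\<^bsub>M\<^esub> x \<in> \<Union>C" using submodule_smult[OF sub(1)] by blast
    qed
    moreover have "D \<subseteq> \<Union>C" using sub(2) C(1) by blast
    moreover have "N \<inter> \<Union>C \<subseteq> {\<zero>\<^bsub>M\<^esub>}" using sub(3) by blast
    ultimately show "\<Union>C \<in> ?S" by simp
  qed
  then obtain C where CS: "C \<in> ?S" and maximal: "\<forall>X\<in>?S. C \<subseteq> X \<longrightarrow> X = C" by (rule bexE)
  have C: "submodule C R M" "D \<subseteq> C" "N \<inter> C \<subseteq> {\<zero>\<^bsub>M\<^esub>}" using CS by simp_all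
  have C_max: "X = C" if "submodule X R M" "D \<subseteq> X" "N \<inter> X \<subseteq> {\<zero>\<^bsub>M\<^esub>}" "C \<subseteq> X" for X
    using maximal[THEN bspec, of X] that by simp
  let ?L = "N <+>\<^bsub>M\<^esub> C"
  have L: "submodule ?L R M" "N \<subseteq> ?L" "C \<subseteq> ?L"
    using submodule_set_add set_add_upper N C(1) by blast+
  have step: "x \<in> ?L" if x: "x \<in> carrier M" and px: "p \<odot>\<^bsub>M\<^esub> x \<in> ?L" for x
  proof -
    obtain w c where wc: "w \<in> N" "c \<in> C" "p \<odot>\<^bsub>M\<^esub> x = w \<oplus>\<^bsub>M\<^esub> c"
      using px unfolding mem_set_add by blast
    note wc' = submodule_carrier[OF N wc(1)] submodule_carrier[OF C(1) wc(2)]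
    \<comment> \<open>Multiplied by p^k, the equation shows that p^k w lies in both \<open>N\<close>
      and \<open>C\<close>, hence vanishes; so \<open>w\<close> can be divided by \<open>p\<close>
      inside \<open>N\<close>.\<close>
    have "p [^] Suc k \<odot>\<^bsub>M\<^esub> x \<in> D" using x by (auto simp: D_def scalar_image_def)
    moreover have "p [^] Suc k \<odot>\<^bsub>M\<^esub> x = p [^] k \<odot>\<^bsub>M\<^esub> w \<oplus>\<^bsub>M\<^esub> p [^] k \<odot>\<^bsub>M\<^esub> c"
      using x pc wc(3) wc' by (simp add: smult_assoc1 smult_r_distr)
    ultimately have "p [^] k \<odot>\<^bsub>M\<^esub> w \<oplus>\<^bsub>M\<^esub> p [^] k \<odot>\<^bsub>M\<^esub> c \<in> C" using C(2) by auto
    then have "(p [^] k \<odot>\<^bsub>M\<^esub> w \<oplus>\<^bsub>M\<^esub> p [^] k \<odot>\<^bsub>M\<^esub> c) \<ominus>\<^bsub>M\<^esub> p [^] k \<odot>\<^bsub>M\<^esub> c \<in> C"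
      using pc wc(2) by (intro submodule_minus[OF C(1)] submodule_smult[OF C(1)]) auto
    then have "p [^] k \<odot>\<^bsub>M\<^esub> w \<in> C" using minus_add_cancel pc wc' by simp
    moreover have "p [^] k \<odot>\<^bsub>M\<^esub> w \<in> N" using submodule_smult[OF N] wc(1) pc by simp
    ultimately have "p [^] k \<odot>\<^bsub>M\<^esub> w = \<zero>\<^bsub>M\<^esub>" using C(3) by blast
    then obtain z where z: "z \<in> N" "w = p \<odot>\<^bsub>M\<^esub> z" using N_div wc(1) by blast
    note zc = submodule_carrier[OF N z(1)]
    \<comment> \<open>Subtracting \<open>z\<close> leaves an element whose multiple by
      \<open>p\<close> is already in \<open>C\<close>.\<close>
    let ?x = "x \<ominus>\<^bsub>M\<^esub> z"
    have x': "?x \<in> carrier M" using x zc by simp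
    have "p \<odot>\<^bsub>M\<^esub> ?x = c"
      using smult_minus_right[OF pc x zc] wc(3) z(2) wc'
      by (simp add: minus_add_cancel M.a_comm[of "p \<odot>\<^bsub>M\<^esub> z"])
    then have px': "p \<odot>\<^bsub>M\<^esub> ?x \<in> C" using wc(2) by simp
    have "?x \<in> ?L"
    proof (cases "?x \<in> C")
      case True
      then show ?thesis using L(3) by blast
    next
      case False
      \<comment> \<open>By maximality the enlarged submodule meets \<open>N\<close> in some nonzero
        \<open>v\<close>. The scalar \<open>r\<close> in \<open>v\<close> is invertible modulo
        \<open>p\<close>, as otherwise \<open>v\<close> would lie in \<open>C\<close>; this brings
        \<open>?x\<close> into the sum.\<close>
      let ?C = "C <+>\<^bsub>M\<^esub> cyclic_submodule R M ?x"
      have C': "submodule ?C R M" "C \<subseteq> ?C" "?x \<in> ?C"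
        using submodule_set_add set_add_upper C(1) submodule_cyclic[OF x'] cyclic_self[OF x'] by blast+
      then have "\<not> N \<inter> ?C \<subseteq> {\<zero>\<^bsub>M\<^esub>}" using C_max[of ?C] C(2) False by blast
      then obtain v where v: "v \<in> N" "v \<in> ?C" "v \<noteq> \<zero>\<^bsub>M\<^esub>" by blast
      obtain d r where dr: "d \<in> C" "r \<in> carrier R" "v = d \<oplus>\<^bsub>M\<^esub> r \<odot>\<^bsub>M\<^esub> ?x"
        using v(2) unfolding mem_set_add cyclic_submodule_def by blast
      note dc = submodule_carrier[OF C(1) dr(1)]
      from p dr(2) show ?thesis
      proof (cases rule: maximal_generator_cases)
        case (1 s)
        then have "r \<odot>\<^bsub>M\<^esub> ?x = s \<odot>\<^bsub>M\<^esub> (p \<odot>\<^bsub>M\<^esub> ?x)" using x' pc by (simp add: smult_assoc1)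
        then have "v \<in> C" using dr(1,3) px' 1(1) submodule_smult[OF C(1)] submodule_add[OF C(1)] by simp
        then show ?thesis using v C(3) by blast
      next
        case (2 a b)
        have "v \<ominus>\<^bsub>M\<^esub> d \<in> ?L" using v(1) dr(1) L by (intro submodule_minus[OF L(1)]) auto
        moreover have "v \<ominus>\<^bsub>M\<^esub> d = r \<odot>\<^bsub>M\<^esub> ?x"
          using dr dc x' by (simp add: minus_add_cancel M.a_comm[of d])
        ultimately have rx: "r \<odot>\<^bsub>M\<^esub> ?x \<in> ?L" by simp
        have "?x = (a \<otimes> r \<oplus> b \<otimes> p) \<odot>\<^bsub>M\<^esub> ?x" using 2 x' by simp
        also have "\<dots> = a \<odot>\<^bsub>M\<^esub> (r \<odot>\<^bsub>M\<^esub> ?x) \<oplus>\<^bsub>M\<^esub> b \<odot>\<^bsub>M\<^esub> (p \<odot>\<^bsub>M\<^esub> ?x)"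
          using 2(1,2) x' pc dr(2) by (simp add: smult_l_distr smult_assoc1)
        finally have e: "?x = a \<odot>\<^bsub>M\<^esub> (r \<odot>\<^bsub>M\<^esub> ?x) \<oplus>\<^bsub>M\<^esub> b \<odot>\<^bsub>M\<^esub> (p \<odot>\<^bsub>M\<^esub> ?x)" .
        have "p \<odot>\<^bsub>M\<^esub> ?x \<in> ?L" using px' L(3) by blast
        then have "a \<odot>\<^bsub>M\<^esub> (r \<odot>\<^bsub>M\<^esub> ?x) \<oplus>\<^bsub>M\<^esub> b \<odot>\<^bsub>M\<^esub> (p \<odot>\<^bsub>M\<^esub> ?x) \<in> ?L"
          using rx 2(1,2) by (simp add: submodule_add[OF L(1)] submodule_smult[OF L(1)])
        then show ?thesis by (simp only: e[symmetric])
      qed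
    qed
    then have "z \<oplus>\<^bsub>M\<^esub> ?x \<in> ?L" using z(1) L(2) by (intro submodule_add[OF L(1)]) auto
    then show ?thesis using add_minus_cancel[OF x zc] by simp
  qed
  have steps: "x \<in> ?L" if "x \<in> carrier M" "p [^] n \<odot>\<^bsub>M\<^esub> x \<in> ?L" for n :: nat and x
    using that(2)
  proof (induction n)
    case 0
    then show ?case using that(1) by simp
  next
    case (Suc n)
    have "p [^] Suc n \<odot>\<^bsub>M\<^esub> x = p \<odot>\<^bsub>M\<^esub> (p [^] n \<odot>\<^bsub>M\<^esub> x)"
      using that(1) pc by (simp add: smult_assoc1 smult_commute[of p])
    then have "p [^] n \<odot>\<^bsub>M\<^esub> x \<in> ?L" using step[of "p [^] n \<odot>\<^bsub>M\<^esub> x"] Suc.prems that(1) pc by simp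
    then show ?case by (rule Suc.IH)
  qed
  have "x \<in> ?L" if x: "x \<in> carrier M" for x
  proof (rule steps[OF x])
    show "p [^] Suc k \<odot>\<^bsub>M\<^esub> x \<in> ?L"
      using C(2) L(3) x unfolding D_def scalar_image_def by blast
  qed
  then have "?L = carrier M" using submodule_carrier[OF L(1)] by blast
  then show ?thesis using C by blast
qed

lemma exists_projection:
  assumes N: "submodule N R M" and C: "submodule C R M"
    and inter: "N \<inter> C \<subseteq> {\<zero>\<^bsub>M\<^esub>}" and sum: "N <+>\<^bsub>M\<^esub> C = carrier M"
  shows "\<exists>\<pi>\<in>mod_hom R M M. (\<forall>x\<in>carrier M. \<pi> x \<in> N) \<and> (\<forall>x\<in>N. \<pi> x = x)"
proof -
  note Nc = submodule_carrier[OF N] and Cc = submodule_carrier[OF C]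
  have uniq: "n = n'" if "n \<in> N" "c \<in> C" "n' \<in> N" "c' \<in> C" "n \<oplus>\<^bsub>M\<^esub> c = n' \<oplus>\<^bsub>M\<^esub> c'" for n c n' c'
  proof -
    have "n \<ominus>\<^bsub>M\<^esub> n' = c' \<ominus>\<^bsub>M\<^esub> c"
    proof -
      have "n = (n' \<oplus>\<^bsub>M\<^esub> c') \<ominus>\<^bsub>M\<^esub> c"
        using that(5) minus_add_cancel[OF Nc[OF that(1)] Cc[OF that(2)]] by simp
      then have "n = (c' \<ominus>\<^bsub>M\<^esub> c) \<oplus>\<^bsub>M\<^esub> n'"
        using Nc Cc that by (simp add: a_minus_def M.a_ac)
      then show ?thesis using minus_add_cancel[of "c' \<ominus>\<^bsub>M\<^esub> c" n'] Nc Cc that by simp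
    qed
    moreover have "n \<ominus>\<^bsub>M\<^esub> n' \<in> N" "c' \<ominus>\<^bsub>M\<^esub> c \<in> C"
      using submodule_minus[OF N] submodule_minus[OF C] that by blast+
    ultimately have "n \<ominus>\<^bsub>M\<^esub> n' = \<zero>\<^bsub>M\<^esub>" using inter by auto
    then show ?thesis using minus_eq_zero_iff Nc that by simp
  qed
  define \<pi> where "\<pi> x = (THE n. n \<in> N \<and> (\<exists>c\<in>C. x = n \<oplus>\<^bsub>M\<^esub> c))" for x
  have \<pi>: "\<pi> (n \<oplus>\<^bsub>M\<^esub> c) = n" if "n \<in> N" "c \<in> C" for n c
    unfolding \<pi>_def
  proof (rule the_equality)
    show "n \<in> N \<and> (\<exists>c'\<in>C. n \<oplus>\<^bsub>M\<^esub> c = n \<oplus>\<^bsub>M\<^esub> c')" using that by blast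
    fix n' assume "n' \<in> N \<and> (\<exists>c'\<in>C. n \<oplus>\<^bsub>M\<^esub> c = n' \<oplus>\<^bsub>M\<^esub> c')"
    then show "n' = n" using uniq that by blast
  qed
  have dec: "\<exists>n\<in>N. \<exists>c\<in>C. x = n \<oplus>\<^bsub>M\<^esub> c" if "x \<in> carrier M" for x
    using that sum mem_set_add[of x M N C] by blast
  have "\<pi> \<in> mod_hom R M M"
    unfolding mod_hom_def
  proof (intro CollectI conjI ballI)
    show "\<pi> \<in> carrier M \<rightarrow> carrier M"
    proof
      fix x assume "x \<in> carrier M"
      then obtain n c where "n \<in> N" "c \<in> C" "x = n \<oplus>\<^bsub>M\<^esub> c" using dec by blast
      then show "\<pi> x \<in> carrier M" using \<pi> Nc by simp
    qed
    fix x y assume "x \<in> carrier M" "y \<in> carrier M"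
    then obtain n c n' c' where *: "n \<in> N" "c \<in> C" "n' \<in> N" "c' \<in> C"
      "x = n \<oplus>\<^bsub>M\<^esub> c" "y = n' \<oplus>\<^bsub>M\<^esub> c'" using dec by metis
    then have "x \<oplus>\<^bsub>M\<^esub> y = (n \<oplus>\<^bsub>M\<^esub> n') \<oplus>\<^bsub>M\<^esub> (c \<oplus>\<^bsub>M\<^esub> c')"
      using Nc Cc by (simp add: M.a_ac)
    then show "\<pi> (x \<oplus>\<^bsub>M\<^esub> y) = \<pi> x \<oplus>\<^bsub>M\<^esub> \<pi> y"
      using \<pi> * submodule_add[OF N] submodule_add[OF C] by simp
  next
    fix r x assume r: "r \<in> carrier R" and "x \<in> carrier M"
    then obtain n c where *: "n \<in> N" "c \<in> C" "x = n \<oplus>\<^bsub>M\<^esub> c" using dec by blast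
    then have "r \<odot>\<^bsub>M\<^esub> x = r \<odot>\<^bsub>M\<^esub> n \<oplus>\<^bsub>M\<^esub> r \<odot>\<^bsub>M\<^esub> c" using r Nc Cc by (simp add: smult_r_distr)
    then show "\<pi> (r \<odot>\<^bsub>M\<^esub> x) = r \<odot>\<^bsub>M\<^esub> \<pi> x"
      using \<pi> * r submodule_smult[OF N] submodule_smult[OF C] by simp
  qed
  moreover have "\<pi> x \<in> N" if x: "x \<in> carrier M" for x
  proof -
    obtain n c where "n \<in> N" "c \<in> C" "x = n \<oplus>\<^bsub>M\<^esub> c" using dec[OF x] by blast
    then show ?thesis using \<pi> by simp
  qed
  moreover have "\<pi> x = x" if "x \<in> N" for x
    using \<pi>[OF that submodule_zero[OF C]] Nc[OF that] by simp
  ultimately show ?thesis by blast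
qed

text \<open>Prolonged by the identity on the kernel of the retraction, \<open>T\<close> and
  \<open>S\<close> become endomorphisms of \<open>M\<close> whose composite is still the identity.
  The extension of \<open>T\<close> is onto but kills \<open>e\<close>. That of \<open>S\<close> is
  injective, and were it onto, its left inverse would be injective.\<close>

lemma not_hopfian_if_retract:
  assumes N: "submodule N R M"
    and \<pi>: "\<pi> \<in> mod_hom R M M" "\<And>x. x \<in> carrier M \<Longrightarrow> \<pi> x \<in> N" "\<And>x. x \<in> N \<Longrightarrow> \<pi> x = x"
    and T: "T \<in> mod_hom R (M\<lparr>carrier := N\<rparr>) (M\<lparr>carrier := N\<rparr>)"
    and S: "S \<in> mod_hom R (M\<lparr>carrier := N\<rparr>) (M\<lparr>carrier := N\<rparr>)"
    and TS: "\<And>x. x \<in> N \<Longrightarrow> T (S x) = x"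
    and e: "e \<in> N" "e \<noteq> \<zero>\<^bsub>M\<^esub>" "T e = \<zero>\<^bsub>M\<^esub>"
  shows "\<not> hopfian R M" "\<not> co_hopfian R M"
proof -
  note Nc = submodule_carrier[OF N]
  note \<pi>D = mod_homD[OF \<pi>(1)]
  \<comment> \<open>\<open>f\<close> acts on the component of \<open>x\<close> in \<open>N\<close>;
    the component in the kernel of the retraction stays fixed.\<close>
  define ext where "ext f x = f (\<pi> x) \<oplus>\<^bsub>M\<^esub> (x \<ominus>\<^bsub>M\<^esub> \<pi> x)" for f x
  have ext: "ext f \<in> mod_hom R M M" "\<And>x. x \<in> carrier M \<Longrightarrow> f (\<pi> x) \<in> N"
    if f: "f \<in> mod_hom R (M\<lparr>carrier := N\<rparr>) (M\<lparr>carrier := N\<rparr>)" for f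
  proof -
    have fN: "f x \<in> N" if "x \<in> N" for x using mod_homD(1)[OF f] that by simp
    have fa: "f (x \<oplus>\<^bsub>M\<^esub> y) = f x \<oplus>\<^bsub>M\<^esub> f y" if "x \<in> N" "y \<in> N" for x y
      using mod_homD(2)[OF f] that by simp
    have fs: "f (r \<odot>\<^bsub>M\<^esub> x) = r \<odot>\<^bsub>M\<^esub> f x" if "r \<in> carrier R" "x \<in> N" for r x
      using mod_homD(3)[OF f] that by simp
    show 1: "f (\<pi> x) \<in> N" if "x \<in> carrier M" for x using that fN \<pi>(2) by blast
    note c = 1[THEN Nc] \<pi>D(1)
    show "ext f \<in> mod_hom R M M"
      unfolding mod_hom_def
    proof (intro CollectI conjI ballI)
      show "ext f \<in> carrier M \<rightarrow> carrier M" using c by (auto simp: ext_def)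
      fix x y assume xy: "x \<in> carrier M" "y \<in> carrier M"
      then show "ext f (x \<oplus>\<^bsub>M\<^esub> y) = ext f x \<oplus>\<^bsub>M\<^esub> ext f y"
        using c[OF xy(1)] c[OF xy(2)]
        by (simp add: ext_def \<pi>D(2) fa \<pi>(2) a_minus_def M.minus_add M.a_ac)
    next
      fix r x assume "r \<in> carrier R" "x \<in> carrier M"
      then show "ext f (r \<odot>\<^bsub>M\<^esub> x) = r \<odot>\<^bsub>M\<^esub> ext f x"
        using c[of x] by (simp add: ext_def \<pi>D(3) fs \<pi>(2) smult_r_distr smult_minus_right)
    qed
  qed
  have \<pi>_ext: "\<pi> (ext S x) = S (\<pi> x)" if x: "x \<in> carrier M" for x
  proof -
    note c = Nc[OF ext(2)[OF S x]] \<pi>D(1)[OF x]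
    have "\<pi> (x \<ominus>\<^bsub>M\<^esub> \<pi> x) = \<zero>\<^bsub>M\<^esub>"
      using mod_hom_minus[OF module_axioms module_axioms \<pi>(1) x c(2)] \<pi>(3)[OF \<pi>(2)[OF x]] c
      by (simp add: minus_eq_zero_iff)
    then show ?thesis
      using \<pi>D(2)[of "S (\<pi> x)" "x \<ominus>\<^bsub>M\<^esub> \<pi> x"] c x \<pi>(3)[OF ext(2)[OF S x]] by (simp add: ext_def)
  qed
  have inv: "ext T (ext S x) = x" if x: "x \<in> carrier M" for x
  proof -
    note c = Nc[OF ext(2)[OF S x]] \<pi>D(1)[OF x]
    have "ext S x \<ominus>\<^bsub>M\<^esub> S (\<pi> x) = x \<ominus>\<^bsub>M\<^esub> \<pi> x"
      unfolding ext_def using c x by (simp add: M.a_comm[of "S (\<pi> x)"] minus_add_cancel)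
    then have "ext T (ext S x) = \<pi> x \<oplus>\<^bsub>M\<^esub> (x \<ominus>\<^bsub>M\<^esub> \<pi> x)"
      unfolding ext_def[of T] \<pi>_ext[OF x] TS[OF \<pi>(2)[OF x]] by simp
    then show ?thesis using add_minus_cancel[OF x c(2)] by simp
  qed
  have ec: "e \<in> carrier M" using e(1) Nc by blast
  have "ext T e = \<zero>\<^bsub>M\<^esub>" using e ec by (simp add: ext_def \<pi>(3) a_minus_def M.r_neg)
  moreover have "ext T \<zero>\<^bsub>M\<^esub> = \<zero>\<^bsub>M\<^esub>" by (rule mod_hom_zero[OF module_axioms module_axioms ext(1)[OF T]])
  ultimately have not_inj: "\<not> inj_on (ext T) (carrier M)"
    using e(2) ec by (metis M.zero_closed inj_onD)
  note cl = mod_homD(1)[OF ext(1)[OF T]] mod_homD(1)[OF ext(1)[OF S]]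
  have "ext T ` carrier M = carrier M"
  proof
    show "carrier M \<subseteq> ext T ` carrier M"
    proof
      fix x assume "x \<in> carrier M"
      then show "x \<in> ext T ` carrier M" using inv cl(2) by (metis imageI)
    qed
  qed (use cl in blast)
  then show "\<not> hopfian R M"
    using ext(1)[OF T] not_inj unfolding hopfian_def mod_iso_def bij_betw_def by blast
  have "inj_on (ext S) (carrier M)" by (metis inv inj_onI)
  moreover have "ext S ` carrier M \<noteq> carrier M"
  proof
    assume eq: "ext S ` carrier M = carrier M"
    have "inj_on (ext T) (carrier M)"
    proof (rule inj_onI)
      fix x y assume xy: "x \<in> carrier M" "y \<in> carrier M" "ext T x = ext T y"
      obtain u v where "u \<in> carrier M" "v \<in> carrier M" "x = ext S u" "y = ext S v"
        using xy(1,2) eq by (metis imageE)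
      then show "x = y" using xy(3) inv by simp
    qed
    then show False using not_inj by blast
  qed
  ultimately show "\<not> co_hopfian R M"
    using ext(1)[OF S] unfolding co_hopfian_def mod_iso_def bij_betw_def by blast
qed

end

section \<open>Combinations of a sequence and maps on its span\<close>

context module
begin

text \<open>Terms are indexed by position and not by elements, so repetitions in \<open>x\<close>
  count. Coefficients from \<open>n\<close> on are ignored, but later lemmas want all values of
  \<open>c\<close> in the ring, whence the default value zero beyond the length.\<close>

primrec seq_sum :: "(nat \<Rightarrow> 'a) \<Rightarrow> (nat \<Rightarrow> 'c) \<Rightarrow> nat \<Rightarrow> 'c" where
  "seq_sum c x 0 = \<zero>\<^bsub>M\<^esub>"
| "seq_sum c x (Suc n) = seq_sum c x n \<oplus>\<^bsub>M\<^esub> c n \<odot>\<^bsub>M\<^esub> x n"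

lemma seq_sum_mem:
  assumes "submodule H R M" "\<And>j. c j \<in> carrier R" "\<And>j. x j \<in> H"
  shows "seq_sum c x n \<in> H"
  by (induction n)
    (simp_all add: submodule_zero[OF assms(1)] submodule_add[OF assms(1)] submodule_smult[OF assms(1)] assms(2,3))

lemma seq_sum_closed:
  "(\<And>j. c j \<in> carrier R) \<Longrightarrow> (\<And>j. x j \<in> carrier M) \<Longrightarrow> seq_sum c x n \<in> carrier M"
  by (rule seq_sum_mem[OF carrier_is_submodule])

lemma seq_sum_add:
  assumes "\<And>j. c j \<in> carrier R" "\<And>j. e j \<in> carrier R" "\<And>j. x j \<in> carrier M"
  shows "seq_sum (\<lambda>j. c j \<oplus> e j) x n = seq_sum c x n \<oplus>\<^bsub>M\<^esub> seq_sum e x n"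
  by (induction n) (simp_all add: assms seq_sum_closed smult_l_distr M.a_ac)

lemma seq_sum_smult:
  assumes "r \<in> carrier R" "\<And>j. c j \<in> carrier R" "\<And>j. x j \<in> carrier M"
  shows "seq_sum (\<lambda>j. r \<otimes> c j) x n = r \<odot>\<^bsub>M\<^esub> seq_sum c x n"
  by (induction n) (simp_all add: assms seq_sum_closed smult_assoc1 smult_r_distr)

lemma seq_sum_smult_seq:
  assumes "r \<in> carrier R" "\<And>j. c j \<in> carrier R" "\<And>j. x j \<in> carrier M"
  shows "seq_sum c (\<lambda>j. r \<odot>\<^bsub>M\<^esub> x j) n = r \<odot>\<^bsub>M\<^esub> seq_sum c x n"
  by (induction n) (simp_all add: assms seq_sum_closed smult_commute[of _ r] smult_r_distr)

lemma seq_sum_cong: "(\<And>j. j < n \<Longrightarrow> c j = e j) \<Longrightarrow> seq_sum c x n = seq_sum e x n"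
  by (induction n) auto

lemma seq_sum_null:
  "(\<And>j. j < n \<Longrightarrow> c j \<odot>\<^bsub>M\<^esub> x j = \<zero>\<^bsub>M\<^esub>) \<Longrightarrow> seq_sum c x n = \<zero>\<^bsub>M\<^esub>"
  by (induction n) auto

lemma seq_sum_pad:
  assumes "\<And>j. c j \<in> carrier R" "\<And>j. x j \<in> carrier M"
  shows "seq_sum (\<lambda>j. if j < n then c j else \<zero>) x (n + m) = seq_sum c x n"
proof (induction m)
  case 0
  show ?case by simp (rule seq_sum_cong, simp)
next
  case (Suc m)
  then show ?case using assms seq_sum_closed by simp
qed

lemma seq_sum_unit:
  assumes "\<And>j. x j \<in> carrier M"
  shows "seq_sum (\<lambda>j. if j = k then \<one> else \<zero>) x (Suc k) = x k"
proof -
  have "seq_sum (\<lambda>j. if j = k then \<one> else \<zero>) x k = \<zero>\<^bsub>M\<^esub>" by (rule seq_sum_null) (simp add: assms)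
  then show ?thesis by (simp add: assms)
qed

definition seq_span :: "(nat \<Rightarrow> 'c) \<Rightarrow> 'c set" where
  "seq_span x = {seq_sum c x n |c n. \<forall>j. c j \<in> carrier R}"

lemma seq_spanI: "(\<And>j. c j \<in> carrier R) \<Longrightarrow> seq_sum c x n \<in> seq_span x"
  unfolding seq_span_def by blast

text \<open>Zeros pad both combinations to length \<open>n + m\<close>. The padded coefficients do
  not depend on the sequence, so they serve \<open>x\<close> and \<open>y\<close> alike; this is
  what carries relations over in \<open>seq_span_hom\<close>.\<close>

lemma seq_span_common:
  assumes x: "\<And>j. x j \<in> carrier M" and y: "\<And>j. y j \<in> carrier M"
    and c: "\<And>j. c j \<in> carrier R" and e: "\<And>j. e j \<in> carrier R"
  obtains c' e' k where "\<And>j. c' j \<in> carrier R" "\<And>j. e' j \<in> carrier R"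
    "seq_sum c x n = seq_sum c' x k" "seq_sum e x m = seq_sum e' x k"
    "seq_sum c y n = seq_sum c' y k" "seq_sum e y m = seq_sum e' y k"
proof (rule that)
  let ?c = "\<lambda>j. if j < n then c j else \<zero>" and ?e = "\<lambda>j. if j < m then e j else \<zero>"
  show "?c j \<in> carrier R" "?e j \<in> carrier R" for j using c e by auto
  show "seq_sum c x n = seq_sum ?c x (n + m)" "seq_sum c y n = seq_sum ?c y (n + m)"
    by (rule seq_sum_pad[symmetric]; rule c x y)+
  show "seq_sum e x m = seq_sum ?e x (n + m)" "seq_sum e y m = seq_sum ?e y (n + m)"
    unfolding add.commute[of n m] by (rule seq_sum_pad[symmetric]; rule e x y)+
qed

lemma submodule_seq_span:
  assumes x: "\<And>j. x j \<in> carrier M"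
  shows "submodule (seq_span x) R M"
proof (rule submoduleI')
  show "seq_span x \<subseteq> carrier M" unfolding seq_span_def using seq_sum_closed x by blast
  show "\<zero>\<^bsub>M\<^esub> \<in> seq_span x" using seq_spanI[of "\<lambda>_. \<zero>" x 0] by simp
  fix u v assume "u \<in> seq_span x" "v \<in> seq_span x"
  then obtain c n e m where *: "\<And>j. c j \<in> carrier R" "\<And>j. e j \<in> carrier R"
    "u = seq_sum c x n" "v = seq_sum e x m" unfolding seq_span_def by blast
  obtain c' e' k where **: "\<And>j. c' j \<in> carrier R" "\<And>j. e' j \<in> carrier R"
    "u = seq_sum c' x k" "v = seq_sum e' x k"
    using seq_span_common[of x x c e n m] x * by metis
  show "u \<oplus>\<^bsub>M\<^esub> v \<in> seq_span x"
    using seq_spanI[of "\<lambda>j. c' j \<oplus> e' j" x k] seq_sum_add[of c' e' x k] ** x by simp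
next
  fix r u assume r: "r \<in> carrier R" and "u \<in> seq_span x"
  then obtain c n where *: "\<And>j. c j \<in> carrier R" "u = seq_sum c x n"
    unfolding seq_span_def by blast
  show "r \<odot>\<^bsub>M\<^esub> u \<in> seq_span x"
    using seq_spanI[of "\<lambda>j. r \<otimes> c j" x n] seq_sum_smult[of r c x n] * r x by simp
qed

lemma seq_span_base:
  assumes "\<And>j. x j \<in> carrier M"
  shows "x k \<in> seq_span x"
  using seq_spanI[of "\<lambda>j. if j = k then \<one> else \<zero>" x "Suc k"] seq_sum_unit[of x k] assms by simp

text \<open>Two representations of an element differ by a relation among the \<open>x j\<close>,
  which by \<open>rel\<close> also holds for the \<open>y j\<close>. Hence keeping the coefficients
  and replacing each \<open>x j\<close> by \<open>y j\<close> is well defined.\<close>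

lemma seq_span_hom:
  assumes x: "\<And>j. x j \<in> carrier M" and y: "\<And>j. y j \<in> H" and H: "submodule H R M"
    and rel: "\<And>c n. (\<And>j. c j \<in> carrier R) \<Longrightarrow> seq_sum c x n = \<zero>\<^bsub>M\<^esub> \<Longrightarrow> seq_sum c y n = \<zero>\<^bsub>M\<^esub>"
  shows "\<exists>T\<in>mod_hom R (M\<lparr>carrier := seq_span x\<rparr>) (M\<lparr>carrier := H\<rparr>). \<forall>j. T (x j) = y j"
proof -
  have yc: "y j \<in> carrier M" for j using submodule_carrier[OF H y] .
  have uniq: "seq_sum c y n = seq_sum e y m"
    if c: "\<And>j. c j \<in> carrier R" and e: "\<And>j. e j \<in> carrier R"
      and eq: "seq_sum c x n = seq_sum e x m" for c e n m
  proof -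
    obtain c' e' k where *: "\<And>j. c' j \<in> carrier R" "\<And>j. e' j \<in> carrier R"
      "seq_sum c x n = seq_sum c' x k" "seq_sum e x m = seq_sum e' x k"
      "seq_sum c y n = seq_sum c' y k" "seq_sum e y m = seq_sum e' y k"
      by (rule seq_span_common[of x y c e n m, OF x yc c e]) (rule that)
    \<comment> \<open>Subtraction is written through the factor -1, so that
      \<open>seq_sum_add\<close> and \<open>seq_sum_smult\<close> cover it.\<close>
    let ?d = "\<lambda>j. c' j \<oplus> (\<ominus> \<one>) \<otimes> e' j"
    have d: "seq_sum ?d z k = seq_sum c' z k \<ominus>\<^bsub>M\<^esub> seq_sum e' z k" if z: "\<And>j. z j \<in> carrier M" for z
    proof -
      have "seq_sum ?d z k = seq_sum c' z k \<oplus>\<^bsub>M\<^esub> seq_sum (\<lambda>j. (\<ominus> \<one>) \<otimes> e' j) z k"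
        by (rule seq_sum_add) (use * z in auto)
      also have "seq_sum (\<lambda>j. (\<ominus> \<one>) \<otimes> e' j) z k = (\<ominus> \<one>) \<odot>\<^bsub>M\<^esub> seq_sum e' z k"
        by (rule seq_sum_smult) (use * z in auto)
      also have "\<dots> = \<ominus>\<^bsub>M\<^esub> seq_sum e' z k"
        using smult_l_minus[of \<one> "seq_sum e' z k"] seq_sum_closed[of e' z k] * z by simp
      finally show ?thesis by (simp add: a_minus_def)
    qed
    have cl: "seq_sum c' z k \<in> carrier M" "seq_sum e' z k \<in> carrier M" if "\<And>j. z j \<in> carrier M" for z
      using seq_sum_closed * that by blast+
    have "seq_sum ?d x k = \<zero>\<^bsub>M\<^esub>" using d[OF x] eq *(3,4) cl[OF x] minus_eq_zero_iff by simp
    then have "seq_sum ?d y k = \<zero>\<^bsub>M\<^esub>" by (intro rel) (use * in auto)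
    then show ?thesis using d[OF yc] *(5,6) cl[OF yc] minus_eq_zero_iff by simp
  qed
  define T where "T u = (SOME v. \<exists>c n. (\<forall>j. c j \<in> carrier R) \<and> u = seq_sum c x n \<and> v = seq_sum c y n)" for u
  have T: "T (seq_sum c x n) = seq_sum c y n" if c: "\<And>j. c j \<in> carrier R" for c n
  proof -
    let ?P = "\<lambda>v. \<exists>e m. (\<forall>j. e j \<in> carrier R) \<and> seq_sum c x n = seq_sum e x m \<and> v = seq_sum e y m"
    have "?P (T (seq_sum c x n))"
      unfolding T_def by (rule someI[of ?P "seq_sum c y n"]) (use c in blast)
    then show ?thesis using uniq c by metis
  qed
  have "T \<in> mod_hom R (M\<lparr>carrier := seq_span x\<rparr>) (M\<lparr>carrier := H\<rparr>)"
    unfolding mod_hom_def module.simps partial_object.simps ring.simps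
  proof (intro CollectI conjI ballI)
    show "T \<in> carrier (M\<lparr>carrier := seq_span x\<rparr>) \<rightarrow> carrier (M\<lparr>carrier := H\<rparr>)"
    proof
      fix u assume "u \<in> carrier (M\<lparr>carrier := seq_span x\<rparr>)"
      then obtain c n where *: "\<And>j. c j \<in> carrier R" "u = seq_sum c x n"
        unfolding seq_span_def by auto
      then show "T u \<in> carrier (M\<lparr>carrier := H\<rparr>)" using T seq_sum_mem[OF H] y by simp
    qed
    fix u v assume "u \<in> carrier (M\<lparr>carrier := seq_span x\<rparr>)" "v \<in> carrier (M\<lparr>carrier := seq_span x\<rparr>)"
    then have "u \<in> seq_span x" "v \<in> seq_span x" by simp_all
    then obtain c n e m where *: "\<And>j. c j \<in> carrier R" "\<And>j. e j \<in> carrier R"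
      "u = seq_sum c x n" "v = seq_sum e x m" unfolding seq_span_def by blast
    obtain c' e' k where **: "\<And>j. c' j \<in> carrier R" "\<And>j. e' j \<in> carrier R"
      "u = seq_sum c' x k" "v = seq_sum e' x k"
      using seq_span_common[of x x c e n m] x * by metis
    have "u \<oplus>\<^bsub>M\<^esub> v = seq_sum (\<lambda>j. c' j \<oplus> e' j) x k" using seq_sum_add[of c' e' x k] ** x by simp
    then have "T (u \<oplus>\<^bsub>M\<^esub> v) = seq_sum (\<lambda>j. c' j \<oplus> e' j) y k" using T[of "\<lambda>j. c' j \<oplus> e' j"] ** by simp
    then show "T (u \<oplus>\<^bsub>M\<lparr>carrier := seq_span x\<rparr>\<^esub> v) = T u \<oplus>\<^bsub>M\<lparr>carrier := H\<rparr>\<^esub> T v"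
      using seq_sum_add[of c' e' y k] ** yc T by simp
  next
    fix r u assume r: "r \<in> carrier R" and "u \<in> carrier (M\<lparr>carrier := seq_span x\<rparr>)"
    then have "u \<in> seq_span x" by simp
    then obtain c n where *: "\<And>j. c j \<in> carrier R" "u = seq_sum c x n"
      unfolding seq_span_def by blast
    have "r \<odot>\<^bsub>M\<^esub> u = seq_sum (\<lambda>j. r \<otimes> c j) x n" using seq_sum_smult[of r c x n] * x r by simp
    then have "T (r \<odot>\<^bsub>M\<^esub> u) = seq_sum (\<lambda>j. r \<otimes> c j) y n" using T[of "\<lambda>j. r \<otimes> c j"] * r by simp
    then show "T (r \<odot>\<^bsub>M\<lparr>carrier := seq_span x\<rparr>\<^esub> u) = r \<odot>\<^bsub>M\<lparr>carrier := H\<rparr>\<^esub> T u"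
      using seq_sum_smult[of r c y n] * yc r T by simp
  qed
  moreover have "T (x j) = y j" for j
    using T[of "\<lambda>i. if i = j then \<one> else \<zero>" "Suc j"] seq_sum_unit[of x j] seq_sum_unit[of y j] x yc
    by simp
  ultimately show ?thesis by blast
qed

lemma seq_span_hom_eqI:
  assumes x: "\<And>j. x j \<in> carrier M" and f: "f \<in> mod_hom R (M\<lparr>carrier := seq_span x\<rparr>) (M\<lparr>carrier := seq_span x\<rparr>)"
    and fx: "\<And>j. f (x j) = x j" and u: "u \<in> seq_span x"
  shows "f u = u"
proof -
  note N = submodule_seq_span[of x, OF x]
  have f0: "f \<zero>\<^bsub>M\<^esub> = \<zero>\<^bsub>M\<^esub>"
    using mod_hom_zero[OF submodule.submodule_is_module[OF N module_axioms]
        submodule.submodule_is_module[OF N module_axioms] f] by simp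
  have fa: "f (v \<oplus>\<^bsub>M\<^esub> w) = f v \<oplus>\<^bsub>M\<^esub> f w" if "v \<in> seq_span x" "w \<in> seq_span x" for v w
    using mod_homD(2)[OF f] that by simp
  have fs: "f (r \<odot>\<^bsub>M\<^esub> v) = r \<odot>\<^bsub>M\<^esub> f v" if "r \<in> carrier R" "v \<in> seq_span x" for r v
    using mod_homD(3)[OF f] that by simp
  obtain c n where *: "\<And>j. c j \<in> carrier R" "u = seq_sum c x n"
    using u unfolding seq_span_def by blast
  have "f (seq_sum c x n) = seq_sum c x n" for n
    by (induction n)
      (simp_all add: f0 fa fs fx * seq_spanI seq_span_base x submodule_smult[OF N])
  then show ?thesis using * by simp
qed

text \<open>
  The span of the \<open>x j\<close> is a direct sum of copies of \<open>R\<close> modulo the ideal of \<open>p [^] Suc k\<close>: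
  independence of the \<open>p [^] k \<odot> x j\<close> modulo \<open>p [^] Suc k \<odot> M\<close> allows one to divide all coefficients
  of a relation by \<open>p\<close> again and again.
\<close>

lemma seq_sum_coefficients_divisible:
  assumes p: "p \<in> carrier R" and x: "\<And>j. x j \<in> carrier M"
    and ind: "\<And>c n. (\<And>j. c j \<in> carrier R) \<Longrightarrow>
      p [^] k \<odot>\<^bsub>M\<^esub> seq_sum c x n \<in> scalar_image M (p [^] Suc k) (carrier M) \<Longrightarrow>
      \<forall>j<n. \<exists>e\<in>carrier R. c j = e \<otimes> p"
    and c: "\<And>j. c j \<in> carrier R"
    and mem: "seq_sum c x n \<in> scalar_image M (p [^] Suc k) (carrier M)"
    and i: "i \<le> Suc k"
  shows "\<exists>e. (\<forall>j. e j \<in> carrier R) \<and> (\<forall>j<n. c j = e j \<otimes> p [^] i)"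
  using i
proof (induction i)
  case 0
  then show ?case using c by (intro exI[of _ c]) simp
next
  case (Suc i)
  let ?D = "scalar_image M (p [^] Suc k) (carrier M)"
  have D: "submodule ?D R M" using p by (intro submodule_scalar_image carrier_is_submodule) simp
  obtain e where e: "\<And>j. e j \<in> carrier R" "\<And>j. j < n \<Longrightarrow> c j = e j \<otimes> p [^] i"
    using Suc by auto
  have cl: "seq_sum e x n \<in> carrier M" by (rule seq_sum_closed; rule e x)
  have "seq_sum c x n = seq_sum (\<lambda>j. p [^] i \<otimes> e j) x n"
    by (rule seq_sum_cong) (use e p in \<open>simp add: R.m_comm\<close>)
  also have "\<dots> = p [^] i \<odot>\<^bsub>M\<^esub> seq_sum e x n" by (rule seq_sum_smult) (use e p x in auto)
  \<comment> \<open>Since \<open>i\<close> is at most \<open>k\<close>, the factor p^(k-i) raises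
    p^i to p^k, where \<open>ind\<close> applies to the quotients \<open>e j\<close>.\<close>
  finally have "p [^] (k - i) \<odot>\<^bsub>M\<^esub> (p [^] i \<odot>\<^bsub>M\<^esub> seq_sum e x n) \<in> ?D"
    using mem submodule_smult[OF D, of "p [^] (k - i)"] p by simp
  then have "p [^] k \<odot>\<^bsub>M\<^esub> seq_sum e x n \<in> ?D"
    using smult_assoc1[of "p [^] (k - i)" "p [^] i" "seq_sum e x n"] p cl Suc.prems
    by (simp add: R.nat_pow_mult)
  then have "\<forall>j<n. \<exists>f\<in>carrier R. e j = f \<otimes> p" by (intro ind e)
  then obtain f where f: "\<And>j. j < n \<Longrightarrow> f j \<in> carrier R \<and> e j = f j \<otimes> p" by metis
  \<comment> \<open>The new quotients are known only below \<open>n\<close>; zero elsewhere keeps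
    all values in the ring.\<close>
  let ?f = "\<lambda>j. if j < n then f j else \<zero>"
  have "c j = ?f j \<otimes> p [^] Suc i" if "j < n" for j
    using e(2)[OF that] f[OF that] that p by (simp add: R.m_assoc R.m_comm[of p])
  then show ?case using f by (intro exI[of _ ?f]) auto
qed

text \<open>A relation among the \<open>x j\<close>, even one modulo p^(k+1) M, has coefficients
  divisible by p^(k+1), so any sequence killed by p^(k+1) satisfies it. Therefore the span meets
  p^(k+1) M only in zero, and its generators can be shifted in both directions.\<close>

lemma not_hopfian_if_homocyclic:
  assumes p: "maximal_generator R p" and x: "\<And>j. x j \<in> carrier M"
    and px: "\<And>j. p [^] Suc k \<odot>\<^bsub>M\<^esub> x j = \<zero>\<^bsub>M\<^esub>"
    and ind: "\<And>c n. (\<And>j. c j \<in> carrier R) \<Longrightarrow>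
      p [^] k \<odot>\<^bsub>M\<^esub> seq_sum c x n \<in> scalar_image M (p [^] Suc k) (carrier M) \<Longrightarrow>
      \<forall>j<n. \<exists>e\<in>carrier R. c j = e \<otimes> p"
  shows "\<not> hopfian R M" "\<not> co_hopfian R M"
proof -
  note pc = maximal_generator_closed[OF p]
  let ?D = "scalar_image M (p [^] Suc k) (carrier M)"
  let ?N = "seq_span x"
  have D: "submodule ?D R M" using pc by (intro submodule_scalar_image carrier_is_submodule) simp
  note N = submodule_seq_span[of x, OF x]
  have rel: "seq_sum c y n = \<zero>\<^bsub>M\<^esub>"
    if c: "\<And>j. c j \<in> carrier R" and mem: "seq_sum c x n \<in> ?D"
      and y: "\<And>j. y j \<in> carrier M" "\<And>j. p [^] Suc k \<odot>\<^bsub>M\<^esub> y j = \<zero>\<^bsub>M\<^esub>" for c n y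
  proof (rule seq_sum_null)
    obtain e where e: "\<And>j. e j \<in> carrier R" "\<And>j. j < n \<Longrightarrow> c j = e j \<otimes> p [^] Suc k"
      using seq_sum_coefficients_divisible[OF pc x ind c mem order_refl] by metis
    fix j assume "j < n"
    then show "c j \<odot>\<^bsub>M\<^esub> y j = \<zero>\<^bsub>M\<^esub>"
      using e y pc smult_assoc1[of "e j" "p [^] Suc k" "y j"] by (simp del: R.nat_pow_Suc)
  qed
  have "?N \<inter> ?D \<subseteq> {\<zero>\<^bsub>M\<^esub>}"
  proof
    fix u assume u: "u \<in> ?N \<inter> ?D"
    then obtain c n where "\<And>j. c j \<in> carrier R" "u = seq_sum c x n" unfolding seq_span_def by blast
    then show "u \<in> {\<zero>\<^bsub>M\<^esub>}" using rel[of c n x] u x px by simp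
  qed
  \<comment> \<open>When p^k kills \<open>w\<close>, \<open>ind\<close> applies because zero lies in
    \<open>?D\<close>; dividing the coefficients of \<open>w\<close> by \<open>p\<close> gives
    \<open>z\<close>.\<close>
  moreover have "\<exists>z\<in>?N. w = p \<odot>\<^bsub>M\<^esub> z" if w: "w \<in> ?N" "p [^] k \<odot>\<^bsub>M\<^esub> w = \<zero>\<^bsub>M\<^esub>" for w
  proof -
    obtain c n where c: "\<And>j. c j \<in> carrier R" "w = seq_sum c x n"
      using w(1) unfolding seq_span_def by blast
    have "p [^] k \<odot>\<^bsub>M\<^esub> seq_sum c x n \<in> ?D" using w(2) c(2) submodule_zero[OF D] by simp
    then have "\<forall>j<n. \<exists>e\<in>carrier R. c j = e \<otimes> p" by (intro ind c)
    then obtain e where e: "\<And>j. j < n \<Longrightarrow> e j \<in> carrier R \<and> c j = e j \<otimes> p" by metis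
    let ?e = "\<lambda>j. if j < n then e j else \<zero>"
    have e': "?e j \<in> carrier R" for j using e by simp
    have "w = seq_sum (\<lambda>j. p \<otimes> ?e j) x n"
      unfolding c(2) by (rule seq_sum_cong) (use e pc in \<open>simp add: R.m_comm\<close>)
    also have "\<dots> = p \<odot>\<^bsub>M\<^esub> seq_sum ?e x n" by (rule seq_sum_smult) (use e' pc x in auto)
    finally show ?thesis using seq_spanI[of ?e x n, OF e'] by blast
  qed
  ultimately obtain C where C: "submodule C R M" "?N \<inter> C \<subseteq> {\<zero>\<^bsub>M\<^esub>}" "?N <+>\<^bsub>M\<^esub> C = carrier M"
    using exists_complement[OF p N, of k] by blast
  obtain \<pi> where \<pi>: "\<pi> \<in> mod_hom R M M" "\<forall>u\<in>carrier M. \<pi> u \<in> ?N" "\<forall>u\<in>?N. \<pi> u = u"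
    using exists_projection[OF N C] by blast
  let ?M = "M\<lparr>carrier := ?N\<rparr>"
  have hom: "\<exists>T\<in>mod_hom R ?M ?M. \<forall>j. T (x j) = y j"
    if y: "\<And>j. y j \<in> ?N" "\<And>j. p [^] Suc k \<odot>\<^bsub>M\<^esub> y j = \<zero>\<^bsub>M\<^esub>" for y
  proof (rule seq_span_hom[OF x y(1) N])
    fix c n assume c: "\<And>j. c j \<in> carrier R" "seq_sum c x n = \<zero>\<^bsub>M\<^esub>"
    show "seq_sum c y n = \<zero>\<^bsub>M\<^esub>"
      by (rule rel[OF c(1)]) (use c(2) submodule_zero[OF D] submodule_carrier[OF N y(1)] y(2) in simp_all)
  qed
  have xN: "x j \<in> ?N" for j by (rule seq_span_base[of x, OF x])
  \<comment> \<open>\<open>T\<close> shifts the generators down and kills \<open>x 0\<close>;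
    \<open>S\<close> will shift them up and be a right inverse of \<open>T\<close>.\<close>
  have "\<exists>T\<in>mod_hom R ?M ?M. \<forall>j. T (x j) = (case j of 0 \<Rightarrow> \<zero>\<^bsub>M\<^esub> | Suc i \<Rightarrow> x i)"
    by (rule hom) (use xN px pc submodule_zero[OF N] in \<open>simp_all split: nat.split del: R.nat_pow_Suc\<close>)
  then obtain T where T: "T \<in> mod_hom R ?M ?M" "T (x 0) = \<zero>\<^bsub>M\<^esub>" "\<And>j. T (x (Suc j)) = x j"
    by (metis nat.case)
  have "\<exists>S\<in>mod_hom R ?M ?M. \<forall>j. S (x j) = x (Suc j)"
    by (rule hom) (rule xN px)+
  then obtain S where S: "S \<in> mod_hom R ?M ?M" "\<And>j. S (x j) = x (Suc j)" by blast
  have TS: "T (S u) = u" if "u \<in> ?N" for u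
    using seq_span_hom_eqI[OF x mod_hom_comp[OF S(1) T(1)] _ that] S(2) T(3) by simp
  \<comment> \<open>Otherwise the combination of length one with coefficient 1 would make 1 a
    multiple of \<open>p\<close>.\<close>
  have "x 0 \<noteq> \<zero>\<^bsub>M\<^esub>"
  proof
    assume "x 0 = \<zero>\<^bsub>M\<^esub>"
    then have "p [^] k \<odot>\<^bsub>M\<^esub> seq_sum (\<lambda>_. \<one>) x (Suc 0) \<in> ?D"
      using pc submodule_zero[OF D] by simp
    then have "\<forall>j<Suc 0. \<exists>e\<in>carrier R. \<one> = e \<otimes> p" by (rule ind[rotated]) simp
    then show False using maximal_generator_not_unit[OF p] by (metis lessI)
  qed
  then show "\<not> hopfian R M" "\<not> co_hopfian R M"
    using not_hopfian_if_retract[OF N \<pi>(1) _ _ T(1) S(1) TS xN _ T(2)] \<pi>(2,3) by blast+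
qed

end

section \<open>From infinite length to a homocyclic sequence\<close>

context module
begin

text \<open>\<open>V\<close> modulo \<open>W\<close> is a vector space over the residue field of
  \<open>p\<close>. Without a rank it is infinite dimensional, so vectors can be chosen one after
  another outside the span of the earlier ones. In a relation modulo \<open>W\<close> the last
  coefficient is divisible by \<open>p\<close>, its term falls into \<open>W\<close>, and the
  relation gets shorter.\<close>

lemma exists_independent_sequence:
  assumes p: "maximal_generator R p" and W: "submodule W R M" and V: "submodule V R M"
    and WV: "W \<subseteq> V" and pV: "\<And>v. v \<in> V \<Longrightarrow> p \<odot>\<^bsub>M\<^esub> v \<in> W" and nr: "\<not> ranked R M W V"
  shows "\<exists>s. (\<forall>j. s j \<in> V) \<and> (\<forall>c n. (\<forall>j. c j \<in> carrier R) \<longrightarrow> seq_sum c s n \<in> W \<longrightarrow>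
    (\<forall>j<n. \<exists>e\<in>carrier R. c j = e \<otimes> p))"
proof -
  note pc = maximal_generator_closed[OF p]
  note Vc = submodule_carrier[OF V]
  \<comment> \<open>The possible spans so far: being ranked over \<open>W\<close>, they never
    exhaust \<open>V\<close>.\<close>
  define good where "good U \<longleftrightarrow> submodule U R M \<and> W \<subseteq> U \<and> U \<subseteq> V \<and> ranked R M W U" for U
  have "\<exists>v. v \<in> V \<and> v \<notin> U" if "good U" for U
  proof (rule ccontr)
    assume "\<not> ?thesis"
    then have "U = V" using that by (auto simp: good_def)
    then show False using that nr by (simp add: good_def)
  qed
  then obtain g where g: "\<And>U. good U \<Longrightarrow> g U \<in> V" "\<And>U. good U \<Longrightarrow> g U \<notin> U" by metis
  define U where "U n = ((\<lambda>U. U <+>\<^bsub>M\<^esub> cyclic_submodule R M (g U)) ^^ n) W" for n :: nat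
  have U_Suc: "U (Suc n) = U n <+>\<^bsub>M\<^esub> cyclic_submodule R M (g (U n))" for n by (simp add: U_def)
  have good: "good (U n)" for n
  proof (induction n)
    case 0
    show ?case using W WV ranked_refl by (simp add: good_def U_def)
  next
    case (Suc n)
    then have n: "submodule (U n) R M" "W \<subseteq> U n" "U n \<subseteq> V" "ranked R M W (U n)"
      by (simp_all add: good_def)
    note gV = g(1)[OF Suc]
    note cyc = submodule_cyclic[OF Vc[OF gV]]
    have S: "submodule (U (Suc n)) R M" unfolding U_Suc by (rule submodule_set_add[OF n(1) cyc])
    have sub: "U n \<subseteq> U (Suc n)" unfolding U_Suc by (rule set_add_upper(1)[OF n(1) cyc])
    have "ranked R M (U n) (U (Suc n))"
      unfolding U_Suc by (rule ranked_simple_step[OF p n(1) Vc[OF gV]]) (use pV[OF gV] n(2) in blast)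
    then have "ranked R M W (U (Suc n))" by (rule ranked_trans[OF n(1,4) _ n(2) sub S])
    moreover have "U (Suc n) \<subseteq> V"
      unfolding U_Suc by (rule set_add_least[OF V n(3) cyclic_least[OF V gV]])
    ultimately show ?case using S sub n(2) by (auto simp: good_def)
  qed
  have Um: "submodule (U n) R M" "W \<subseteq> U n" for n using good[of n] by (simp_all add: good_def)
  define s where "s n = g (U n)" for n
  have sV: "s n \<in> V" and sU: "s n \<notin> U n" for n using g good by (simp_all add: s_def)
  have sc: "s n \<in> carrier M" for n using Vc sV by blast
  have U_mono: "U n \<subseteq> U (Suc n)" and s_mem: "s n \<in> U (Suc n)" for n
    unfolding U_Suc s_def[symmetric]
    using set_add_upper[OF Um(1) submodule_cyclic[OF sc]] cyclic_self[OF sc] by blast+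
  have sum_mem: "seq_sum c s n \<in> U n" if c: "\<And>j. c j \<in> carrier R" for c n
  proof (induction n)
    case 0
    show ?case using submodule_zero[OF Um(1)] by simp
  next
    case (Suc n)
    then have "seq_sum c s n \<in> U (Suc n)" using U_mono by blast
    then show ?case
      using submodule_add[OF Um(1)] submodule_smult[OF Um(1) c s_mem] by simp
  qed
  have "\<forall>j<n. \<exists>e\<in>carrier R. c j = e \<otimes> p"
    if c: "\<And>j. c j \<in> carrier R" and mem: "seq_sum c s n \<in> W" for c n
    using mem
  proof (induction n)
    case (Suc n)
    let ?t = "seq_sum c s n"
    have tc: "?t \<in> carrier M" by (rule seq_sum_closed; rule c sc)
    have t: "?t \<in> U n" by (rule sum_mem; rule c)
    have diff: "(?t \<oplus>\<^bsub>M\<^esub> c n \<odot>\<^bsub>M\<^esub> s n) \<ominus>\<^bsub>M\<^esub> c n \<odot>\<^bsub>M\<^esub> s n = ?t"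
      "(?t \<oplus>\<^bsub>M\<^esub> c n \<odot>\<^bsub>M\<^esub> s n) \<ominus>\<^bsub>M\<^esub> ?t = c n \<odot>\<^bsub>M\<^esub> s n"
      using minus_add_cancel[of ?t "c n \<odot>\<^bsub>M\<^esub> s n"] minus_add_cancel[of "c n \<odot>\<^bsub>M\<^esub> s n" ?t] tc c sc
      by (simp_all add: M.a_comm)
    \<comment> \<open>If \<open>c n\<close> were invertible modulo \<open>p\<close>, then
      \<open>s n\<close> would lie in \<open>U n\<close>, against its choice.\<close>
    have last: "\<exists>e\<in>carrier R. c n = e \<otimes> p"
      using p c[of n]
    proof (cases rule: maximal_generator_cases)
      case (1 e)
      then show ?thesis by blast
    next
      case (2 a b)
      have "?t \<oplus>\<^bsub>M\<^esub> c n \<odot>\<^bsub>M\<^esub> s n \<in> U n" using Suc.prems Um(2) by auto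
      then have "c n \<odot>\<^bsub>M\<^esub> s n \<in> U n" using submodule_minus[OF Um(1) _ t] diff(2) by metis
      moreover have "p \<odot>\<^bsub>M\<^esub> s n \<in> U n" using pV[OF sV] Um(2) by blast
      ultimately have "a \<odot>\<^bsub>M\<^esub> (c n \<odot>\<^bsub>M\<^esub> s n) \<oplus>\<^bsub>M\<^esub> b \<odot>\<^bsub>M\<^esub> (p \<odot>\<^bsub>M\<^esub> s n) \<in> U n"
        using 2(1,2) by (simp add: submodule_add[OF Um(1)] submodule_smult[OF Um(1)])
      moreover have "a \<odot>\<^bsub>M\<^esub> (c n \<odot>\<^bsub>M\<^esub> s n) \<oplus>\<^bsub>M\<^esub> b \<odot>\<^bsub>M\<^esub> (p \<odot>\<^bsub>M\<^esub> s n) = (a \<otimes> c n \<oplus> b \<otimes> p) \<odot>\<^bsub>M\<^esub> s n"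
        using 2(1,2) sc pc c by (simp add: smult_l_distr smult_assoc1)
      ultimately show ?thesis using 2(3) sc sU by simp
    qed
    then obtain e where e: "e \<in> carrier R" "c n = e \<otimes> p" by blast
    have "c n \<odot>\<^bsub>M\<^esub> s n \<in> W"
      using submodule_smult[OF W e(1) pV[OF sV]] e sc pc by (simp add: smult_assoc1)
    then have "?t \<in> W"
      using submodule_minus[OF W, of "?t \<oplus>\<^bsub>M\<^esub> c n \<odot>\<^bsub>M\<^esub> s n"] Suc.prems diff(1)
      by (metis seq_sum.simps(2))
    then show ?case using Suc.IH last by (simp add: less_Suc_eq)
  qed simp
  then show ?thesis using sV by (intro exI[of _ s]) simp
qed

text \<open>The filtration \<open>V k\<close> of the p-socle reduces the claim to its layers. A
  layer without a rank contains an independent sequence, and preimages of its terms under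
  multiplication by p^k span the homocyclic summand that \<open>hopf\<close> excludes.\<close>

lemma hopfian_or_co_hopfian_imp_ranked:
  assumes art: "artinian_ring R" and pir: "principal_ideal_ring R"
    and hopf: "hopfian R M \<or> co_hopfian R M"
  shows "ranked R M {\<zero>\<^bsub>M\<^esub>} (carrier M)"
proof (rule ranked_if_socles_ranked[OF art pir])
  fix p assume p: "maximal_generator R p"
  note pc = maximal_generator_closed[OF p]
  define D where "D k = scalar_image M (p [^] k) (carrier M)" for k :: nat
  define V where "V k = D k \<inter> scalar_kernel R M p" for k
  have D: "submodule (D k) R M" for k
    unfolding D_def using pc by (intro submodule_scalar_image carrier_is_submodule) simp
  have V: "submodule (V k) R M" for k
    unfolding V_def by (intro submodule_inter D submodule_scalar_kernel pc)
  have "D (Suc k) \<subseteq> D k" for k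
  proof
    fix y assume "y \<in> D (Suc k)"
    then obtain x where x: "x \<in> carrier M" "y = p [^] Suc k \<odot>\<^bsub>M\<^esub> x"
      unfolding D_def scalar_image_def by blast
    then have "y = p [^] k \<odot>\<^bsub>M\<^esub> (p \<odot>\<^bsub>M\<^esub> x)" using pc by (simp add: smult_assoc1)
    then show "y \<in> D k" using x(1) pc unfolding D_def scalar_image_def by blast
  qed
  then have V_dec: "V (Suc k) \<subseteq> V k" for k unfolding V_def by blast
  have V_zero: "scalar_kernel R M p \<subseteq> V 0"
    unfolding V_def D_def scalar_kernel_def scalar_image_def by (force intro: image_eqI)
  obtain n u where nu: "u \<in> carrier R" "p [^] (n :: nat) = u \<otimes> p [^] Suc n"
    using artinian_power_stable[OF art pc] by blast
  \<comment> \<open>For y = p^n x the stationary power gives y = u p^(n+1) x = u (p y), and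
    \<open>p\<close> kills y.\<close>
  have V_n: "V n \<subseteq> {\<zero>\<^bsub>M\<^esub>}"
  proof
    fix y assume "y \<in> V n"
    then obtain x where x: "x \<in> carrier M" "y = p [^] n \<odot>\<^bsub>M\<^esub> x" "p \<odot>\<^bsub>M\<^esub> y = \<zero>\<^bsub>M\<^esub>"
      unfolding V_def D_def scalar_image_def scalar_kernel_def by blast
    have "y = (u \<otimes> p [^] Suc n) \<odot>\<^bsub>M\<^esub> x" using x(2) by (simp only: nu(2)[symmetric])
    also have "\<dots> = u \<odot>\<^bsub>M\<^esub> (p \<odot>\<^bsub>M\<^esub> y)"
      using x(1,2) nu(1) pc by (simp add: smult_assoc1 smult_commute[of p])
    finally show "y \<in> {\<zero>\<^bsub>M\<^esub>}" using x(3) nu(1) by simp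
  qed
  have step: "ranked R M (V (Suc k)) (V k)" for k
  proof (rule ccontr)
    assume nr: "\<not> ?thesis"
    have "p \<odot>\<^bsub>M\<^esub> v \<in> V (Suc k)" if "v \<in> V k" for v
      using that submodule_zero[OF V] by (simp add: V_def[of k] scalar_kernel_def)
    then obtain s where s: "\<And>j. s j \<in> V k"
      and ind: "\<And>c n. (\<And>j. c j \<in> carrier R) \<Longrightarrow> seq_sum c s n \<in> V (Suc k) \<Longrightarrow>
        \<forall>j<n. \<exists>e\<in>carrier R. c j = e \<otimes> p"
      using exists_independent_sequence[OF p V V V_dec _ nr] by blast
    have "\<exists>x. x \<in> carrier M \<and> s j = p [^] k \<odot>\<^bsub>M\<^esub> x" for j
      using s[of j] unfolding V_def D_def scalar_image_def by blast
    then obtain x where x: "\<And>j. x j \<in> carrier M" "\<And>j. s j = p [^] k \<odot>\<^bsub>M\<^esub> x j" by metis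
    have sK: "s j \<in> scalar_kernel R M p" for j using s[of j] unfolding V_def by blast
    have px: "p [^] Suc k \<odot>\<^bsub>M\<^esub> x j = \<zero>\<^bsub>M\<^esub>" for j
    proof -
      have "p [^] Suc k \<odot>\<^bsub>M\<^esub> x j = p \<odot>\<^bsub>M\<^esub> s j"
        using x pc by (simp add: smult_assoc1 smult_commute[of p])
      then show ?thesis using sK by (simp add: scalar_kernel_def)
    qed
    have "\<forall>j<n. \<exists>e\<in>carrier R. c j = e \<otimes> p"
      if c: "\<And>j. c j \<in> carrier R"
        and mem: "p [^] k \<odot>\<^bsub>M\<^esub> seq_sum c x n \<in> scalar_image M (p [^] Suc k) (carrier M)" for c n
    proof (rule ind[OF c])
      \<comment> \<open>\<open>p\<close> kills the combination of the \<open>s j\<close> in any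
        case, so lying in p^(k+1) M is enough to put it into the next layer.\<close>
      have "s = (\<lambda>j. p [^] k \<odot>\<^bsub>M\<^esub> x j)" using x(2) by blast
      then have "seq_sum c s n = p [^] k \<odot>\<^bsub>M\<^esub> seq_sum c x n"
        using seq_sum_smult_seq[of "p [^] k" c x n] c x(1) pc by simp
      moreover have "seq_sum c s n \<in> scalar_kernel R M p"
        by (rule seq_sum_mem[OF submodule_scalar_kernel[OF pc]]) (rule c sK)+
      ultimately show "seq_sum c s n \<in> V (Suc k)" using mem unfolding V_def D_def by simp
    qed
    then show False using not_hopfian_if_homocyclic[of p x k, OF p x(1) px] hopf by blast
  qed
  have "V m \<subseteq> V 0 \<and> ranked R M (V m) (V 0)" for m
  proof (induction m)
    case 0
    show ?case using ranked_refl by blast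
  next
    case (Suc m)
    then show ?case using ranked_trans[OF V step _ V_dec _ V] V_dec by blast
  qed
  then show "ranked R M {\<zero>\<^bsub>M\<^esub>} (scalar_kernel R M p)"
    using ranked_mono[OF _ V_n V_zero] by blast
qed

text \<open>A rank gives both chain conditions, these give the two Hopf properties, and either Hopf
  property gives back a rank. Finite length and finite generation are compared with ranks
  directly.\<close>

lemma finiteness_conditions_iff_ranked:
  assumes art: "artinian_ring R" and pir: "principal_ideal_ring R"
  shows "hopfian R M \<longleftrightarrow> ranked R M {\<zero>\<^bsub>M\<^esub>} (carrier M)"
    and "co_hopfian R M \<longleftrightarrow> ranked R M {\<zero>\<^bsub>M\<^esub>} (carrier M)"
    and "finitely_generated R M \<longleftrightarrow> ranked R M {\<zero>\<^bsub>M\<^esub>} (carrier M)"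
    and "finite_length R M \<longleftrightarrow> ranked R M {\<zero>\<^bsub>M\<^esub>} (carrier M)"
    and "noetherian_module R M \<longleftrightarrow> ranked R M {\<zero>\<^bsub>M\<^esub>} (carrier M)"
    and "artinian_module R M \<longleftrightarrow> ranked R M {\<zero>\<^bsub>M\<^esub>} (carrier M)"
  using hopfian_or_co_hopfian_imp_ranked[OF art pir] noetherian_imp_hopfian artinian_imp_co_hopfian
    ranked_imp_noetherian ranked_imp_artinian ranked_imp_finitely_generated
    finitely_generated_imp_ranked[OF art pir] ranked_imp_finite_length finite_length_imp_ranked
  by blast+

end

section \<open>Injective envelopes\<close>

lemma injective_envelopeD:
  assumes "injective_envelope R M E i"
  shows "module R M" "module R E" "i \<in> mod_hom R M E" "inj_on i (carrier M)"
    and "injective_module R E" "essential_submodule (i ` carrier M) R E"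
  using assms by (auto simp: injective_envelope_def injective_module_def injective_over_def)

lemma essential_meets:
  assumes E: "module R E" and H: "essential_submodule H R E"
    and N: "submodule N R E" and x: "x \<in> N" "x \<noteq> \<zero>\<^bsub>E\<^esub>"
  obtains y where "y \<in> H" "y \<in> N" "y \<noteq> \<zero>\<^bsub>E\<^esub>"
proof -
  interpret E: module R E by (rule E)
  have "submodule H R E" "H \<inter> N \<noteq> {\<zero>\<^bsub>E\<^esub>}"
    using H N x unfolding essential_submodule_def by blast+
  then show thesis using that E.submodule_zero N by blast
qed

lemma essential_submoduleI:
  assumes E: "module R E" and H: "submodule H R E"
    and "\<And>N x. submodule N R E \<Longrightarrow> x \<in> N \<Longrightarrow> x \<noteq> \<zero>\<^bsub>E\<^esub> \<Longrightarrow> \<exists>y\<in>H \<inter> N. y \<noteq> \<zero>\<^bsub>E\<^esub>"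
  shows "essential_submodule H R E"
  unfolding essential_submodule_def
proof (intro conjI allI impI H)
  interpret E: module R E by (rule E)
  fix N assume N: "submodule N R E \<and> N \<noteq> {\<zero>\<^bsub>E\<^esub>}"
  then obtain x where "x \<in> N" "x \<noteq> \<zero>\<^bsub>E\<^esub>" using E.submodule_zero by blast
  then show "H \<inter> N \<noteq> {\<zero>\<^bsub>E\<^esub>}" using assms(3) N by blast
qed

lemma ranked_if_embeds:
  assumes M: "module R M" and N: "module R N" and f: "f \<in> mod_hom R M N" "inj_on f (carrier M)"
    and r: "ranked R N {\<zero>\<^bsub>N\<^esub>} (carrier N)"
  shows "ranked R M {\<zero>\<^bsub>M\<^esub>} (carrier M)"
proof -
  interpret M: module R M by (rule M)
  interpret N: module R N by (rule N)
  obtain d where d: "\<And>H K. submodule H R N \<Longrightarrow> submodule K R N \<Longrightarrow> {\<zero>\<^bsub>N\<^esub>} \<subseteq> H \<Longrightarrow> H \<subset> K \<Longrightarrow>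
      K \<subseteq> carrier N \<Longrightarrow> d H < (d K :: nat)"
    by (rule rankedE[OF r], rule that)
  show ?thesis
  proof (rule rankedI[where d = "\<lambda>H. d (f ` H)"])
    fix H K assume H: "submodule H R M" and K: "submodule K R M" and HK: "H \<subset> K" "K \<subseteq> carrier M"
    note im = mod_hom_image[OF M N f(1) H] mod_hom_image[OF M N f(1) K]
    have "f ` H \<subset> f ` K" using image_strict_mono[OF inj_on_subset[OF f(2) HK(2)] HK(1)] .
    then show "d (f ` H) < d (f ` K)"
      using d[OF im] N.submodule_zero[OF im(1)] N.submodule_carrier[OF im(2)] by blast
  qed
qed

text \<open>A nonzero \<open>x\<close> killed by \<open>p\<close> generates a simple submodule:
  \<open>H\<close> contains some nonzero r x, there \<open>r\<close> is invertible modulo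
  \<open>p\<close>, and so \<open>x\<close> is a multiple of r x.\<close>

lemma socle_in_essential:
  assumes E: "module R E" and H: "essential_submodule H R E" and p: "maximal_generator R p"
  shows "scalar_kernel R E p \<subseteq> H"
proof
  interpret E: module R E by (rule E)
  have Hs: "submodule H R E" using H by (simp add: essential_submodule_def)
  fix x assume "x \<in> scalar_kernel R E p"
  then have x: "x \<in> carrier E" "p \<odot>\<^bsub>E\<^esub> x = \<zero>\<^bsub>E\<^esub>" by (simp_all add: scalar_kernel_def)
  note pc = E.maximal_generator_closed[OF p]
  show "x \<in> H"
  proof (cases "x = \<zero>\<^bsub>E\<^esub>")
    case True
    then show ?thesis using E.submodule_zero[OF Hs] by simp
  next
    case False
    obtain y where y: "y \<in> H" "y \<in> cyclic_submodule R E x" "y \<noteq> \<zero>\<^bsub>E\<^esub>"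
      using essential_meets[OF E H E.submodule_cyclic[OF x(1)] E.cyclic_self[OF x(1)] False] by blast
    obtain r where r: "r \<in> carrier R" "y = r \<odot>\<^bsub>E\<^esub> x"
      using y(2) unfolding cyclic_submodule_def by blast
    from p r(1) show ?thesis
    proof (cases rule: E.maximal_generator_cases)
      case (1 s)
      then have "y = s \<odot>\<^bsub>E\<^esub> (p \<odot>\<^bsub>E\<^esub> x)" using r x pc by (simp add: E.smult_assoc1)
      then show ?thesis using x(2) 1(1) y(3) by simp
    next
      case (2 a b)
      have "x = (a \<otimes>\<^bsub>R\<^esub> r \<oplus>\<^bsub>R\<^esub> b \<otimes>\<^bsub>R\<^esub> p) \<odot>\<^bsub>E\<^esub> x" using 2 x by simp
      also have "\<dots> = a \<odot>\<^bsub>E\<^esub> y \<oplus>\<^bsub>E\<^esub> b \<odot>\<^bsub>E\<^esub> (p \<odot>\<^bsub>E\<^esub> x)"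
        using 2(1,2) x(1) pc r by (simp add: E.smult_l_distr E.smult_assoc1)
      also have "\<dots> = a \<odot>\<^bsub>E\<^esub> y" using x(2) 2(1,2) r x(1) by simp
      finally show ?thesis using E.submodule_smult[OF Hs 2(1) y(1)] by simp
    qed
  qed
qed

text \<open>Towards \<open>E\<close>, only submodules of p-socles have to be ranked. They lie in the
  image of \<open>i\<close>, so passing to preimages in \<open>M\<close> keeps inclusions strict and
  the rank of \<open>M\<close> can be reused.\<close>

lemma ranked_envelope_iff:
  assumes art: "artinian_ring R" and pir: "principal_ideal_ring R"
    and env: "injective_envelope R M E i"
  shows "ranked R M {\<zero>\<^bsub>M\<^esub>} (carrier M) \<longleftrightarrow> ranked R E {\<zero>\<^bsub>E\<^esub>} (carrier E)"
proof
  note D = injective_envelopeD[OF env]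
  interpret M: module R M by (rule D)
  interpret E: module R E by (rule D)
  show "ranked R M {\<zero>\<^bsub>M\<^esub>} (carrier M)" if "ranked R E {\<zero>\<^bsub>E\<^esub>} (carrier E)"
    by (rule ranked_if_embeds[OF D(1-4) that])
  assume r: "ranked R M {\<zero>\<^bsub>M\<^esub>} (carrier M)"
  obtain d where d: "\<And>H K. submodule H R M \<Longrightarrow> submodule K R M \<Longrightarrow> {\<zero>\<^bsub>M\<^esub>} \<subseteq> H \<Longrightarrow> H \<subset> K \<Longrightarrow>
      K \<subseteq> carrier M \<Longrightarrow> d H < (d K :: nat)"
    by (rule rankedE[OF r], rule that)
  show "ranked R E {\<zero>\<^bsub>E\<^esub>} (carrier E)"
  proof (rule E.ranked_if_socles_ranked[OF art pir])
    fix p assume p: "maximal_generator R p"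
    show "ranked R E {\<zero>\<^bsub>E\<^esub>} (scalar_kernel R E p)"
    proof (rule rankedI[where d = "\<lambda>H. d {x \<in> carrier M. i x \<in> H}"])
      fix H K assume H: "submodule H R E" and K: "submodule K R E"
        and HK: "H \<subset> K" "K \<subseteq> scalar_kernel R E p"
      obtain y where y: "y \<in> K" "y \<notin> H" using HK(1) by blast
      then obtain x where x: "x \<in> carrier M" "y = i x"
        using socle_in_essential[OF D(2,6) p] HK(2) by blast
      have pre: "submodule {x \<in> carrier M. i x \<in> H} R M" "submodule {x \<in> carrier M. i x \<in> K} R M"
        by (rule mod_hom_vimage[OF D(1-3)]; rule H K)+
      have "{x \<in> carrier M. i x \<in> H} \<subset> {x \<in> carrier M. i x \<in> K}" using x y HK(1) by blast
      then show "d {x \<in> carrier M. i x \<in> H} < d {x \<in> carrier M. i x \<in> K}"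
        using d[OF pre] M.submodule_zero[OF pre(1)] by blast
    qed
  qed
qed

text \<open>Essential extensions compose: a nonzero submodule of \<open>F\<close> meets the image of
  \<open>E\<close>, so its preimage in \<open>E\<close> is nonzero and meets the image of
  \<open>M\<close>.\<close>

lemma injective_envelope_comp:
  assumes env: "injective_envelope R M E i" and env0: "injective_envelope R E F j"
  shows "injective_envelope R M F (\<lambda>x. j (i x))"
proof -
  note D = injective_envelopeD[OF env] and D0 = injective_envelopeD[OF env0]
  interpret F: module R F by (rule D0)
  note hom = mod_hom_comp[OF D(3) D0(3)]
  note iD = mod_homD(1)[OF D(3)]
  have "inj_on (\<lambda>x. j (i x)) (carrier M)"
  proof (rule inj_onI)
    fix x y assume *: "x \<in> carrier M" "y \<in> carrier M" "j (i x) = j (i y)"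
    then have "i x = i y" using inj_onD[OF D0(4)] iD by blast
    then show "x = y" using inj_onD[OF D(4)] * by blast
  qed
  moreover have "essential_submodule ((\<lambda>x. j (i x)) ` carrier M) R F"
  proof (rule essential_submoduleI[OF D0(2)])
    show "submodule ((\<lambda>x. j (i x)) ` carrier M) R F"
      by (rule mod_hom_image[OF D(1) D0(2) hom module.carrier_is_submodule[OF D(1)]])
    fix N x assume N: "submodule N R F" "x \<in> N" "x \<noteq> \<zero>\<^bsub>F\<^esub>"
    obtain y where y: "y \<in> j ` carrier E" "y \<in> N" "y \<noteq> \<zero>\<^bsub>F\<^esub>"
      using essential_meets[OF D0(2,6) N] by blast
    then obtain e where e: "e \<in> carrier E" "y = j e" by blast
    have "e \<noteq> \<zero>\<^bsub>E\<^esub>" using y e mod_hom_zero[OF D0(1-3)] by auto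
    then obtain z where z: "z \<in> i ` carrier M" "z \<in> {e \<in> carrier E. j e \<in> N}" "z \<noteq> \<zero>\<^bsub>E\<^esub>"
      using essential_meets[OF D(2,6) mod_hom_vimage[OF D0(1-3) N(1)], of e] e y by blast
    have "j z \<noteq> \<zero>\<^bsub>F\<^esub>"
    proof
      assume "j z = \<zero>\<^bsub>F\<^esub>"
      then have "j z = j \<zero>\<^bsub>E\<^esub>" using mod_hom_zero[OF D0(1-3)] by simp
      moreover have "\<zero>\<^bsub>E\<^esub> \<in> carrier E"
        by (rule module.submodule_zero[OF D(2) module.carrier_is_submodule[OF D(2)]])
      ultimately show False using inj_onD[OF D0(4)] z by blast
    qed
    then show "\<exists>y\<in>(\<lambda>x. j (i x)) ` carrier M \<inter> N. y \<noteq> \<zero>\<^bsub>F\<^esub>" using z by blast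
  qed
  ultimately show ?thesis using D(1) D0(5) hom by (simp add: injective_envelope_def)
qed

text \<open>Injectivity of \<open>F\<close> extends \<open>j\<close> along \<open>i\<close> to
  \<open>h\<close>. As \<open>j\<close> is injective, the kernel of \<open>h\<close> meets the image
  of \<open>M\<close> only in zero and vanishes by essentiality. The image of \<open>h\<close>
  contains that of \<open>j\<close> and is therefore essential.\<close>

lemma injective_envelope_extend:
  assumes env: "injective_envelope R M E i" and env0: "injective_envelope R M F j"
  shows "\<exists>h. injective_envelope R E F h"
proof -
  note D = injective_envelopeD[OF env] and D0 = injective_envelopeD[OF env0]
  obtain h where h: "h \<in> mod_hom R E F" "\<forall>x\<in>carrier M. h (i x) = j x"
    using injective_module_over[OF D0(5) D(1,2,3,4) D0(3)] by blast
  note EF = D(2) D0(2) h(1)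
  have triv: "submodule {\<zero>\<^bsub>F\<^esub>} R F" by (rule module.submodule_trivial[OF D0(2)])
  have "inj_on h (carrier E)"
  proof (rule mod_hom_inj_onI[OF EF], rule ccontr)
    fix x assume x: "x \<in> carrier E" "h x = \<zero>\<^bsub>F\<^esub>" "x \<noteq> \<zero>\<^bsub>E\<^esub>"
    obtain y where y: "y \<in> i ` carrier M" "y \<in> {e \<in> carrier E. h e \<in> {\<zero>\<^bsub>F\<^esub>}}" "y \<noteq> \<zero>\<^bsub>E\<^esub>"
      using essential_meets[OF D(2,6) mod_hom_vimage[OF EF triv], of x] x by blast
    then obtain m where m: "m \<in> carrier M" "y = i m" by blast
    have zM: "\<zero>\<^bsub>M\<^esub> \<in> carrier M"
      by (rule module.submodule_zero[OF D(1) module.carrier_is_submodule[OF D(1)]])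
    have "j m = \<zero>\<^bsub>F\<^esub>" using h(2) m y(2) by auto
    then have "j m = j \<zero>\<^bsub>M\<^esub>" using mod_hom_zero[OF D0(1-3)] by simp
    then have "m = \<zero>\<^bsub>M\<^esub>" using inj_onD[OF D0(4)] m(1) zM by blast
    then show False using m(2) y(3) mod_hom_zero[OF D(1-3)] by simp
  qed
  moreover have "essential_submodule (h ` carrier E) R F"
  proof (rule essential_submoduleI[OF D0(2)])
    show "submodule (h ` carrier E) R F"
      by (rule mod_hom_image[OF EF module.carrier_is_submodule[OF D(2)]])
    fix N x assume N: "submodule N R F" "x \<in> N" "x \<noteq> \<zero>\<^bsub>F\<^esub>"
    obtain y where y: "y \<in> j ` carrier M" "y \<in> N" "y \<noteq> \<zero>\<^bsub>F\<^esub>"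
      using essential_meets[OF D0(2,6) N] by blast
    have "j ` carrier M \<subseteq> h ` carrier E"
    proof
      fix z assume "z \<in> j ` carrier M"
      then obtain m where m: "m \<in> carrier M" "z = h (i m)" using h(2) by auto
      then show "z \<in> h ` carrier E" using mod_homD(1)[OF D(3) m(1)] by blast
    qed
    then show "\<exists>y\<in>h ` carrier E \<inter> N. y \<noteq> \<zero>\<^bsub>F\<^esub>" using y by blast
  qed
  ultimately show ?thesis using D(2) D0(5) h(1) by (auto simp: injective_envelope_def)
qed

theorem corollary3p10:
  fixes R :: "('r, 'k) ring_scheme"
    and M :: "('r, 'm) module"
    and E :: "('r, 'e) module"
    and i :: "'m \<Rightarrow> 'e"
  assumes "cring R"
    and "\<one>\<^bsub>R\<^esub> \<noteq> \<zero>\<^bsub>R\<^esub>"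
    and "artinian_ring R"
    and "principal_ideal_ring R"
    and "module R M"
    and "injective_envelope R M E i"
  shows "(hopfian R M \<longleftrightarrow> hopfian R E) \<and>
         (co_hopfian R M \<longleftrightarrow> co_hopfian R E) \<and>
         (finitely_generated R M \<longleftrightarrow> finitely_generated R E) \<and>
         (finite_length R M \<longleftrightarrow> finite_length R E) \<and>
         (noetherian_module R M \<longleftrightarrow> noetherian_module R E) \<and>
         (artinian_module R M \<longleftrightarrow> artinian_module R E) \<and>
         (finitely_cogenerated TYPE('e) R M \<longleftrightarrow> finitely_cogenerated TYPE('e) R E)"
proof -
  note E = injective_envelopeD(2)[OF assms(6)]
  note iffM = module.finiteness_conditions_iff_ranked[OF assms(5,3,4)]
    and iffE = module.finiteness_conditions_iff_ranked[OF E assms(3,4)]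
  \<comment> \<open>The same modules \<open>F\<close> are envelopes of \<open>M\<close> and of
    \<open>E\<close>, though through different embeddings; hence the existential over
    \<open>j\<close> on both sides.\<close>
  have envs: "(\<exists>j. injective_envelope R M F j) \<longleftrightarrow> (\<exists>j. injective_envelope R E F j)"
    for F :: "('r, 'e) module"
    using injective_envelope_comp[OF assms(6)] injective_envelope_extend[OF assms(6)] by blast
  \<comment> \<open>The embedding occurs only in the envelope clause of the definition, so
    \<open>ex_simps\<close> isolates the existential that \<open>envs\<close> rewrites.\<close>
  have "finitely_cogenerated TYPE('e) R M \<longleftrightarrow> finitely_cogenerated TYPE('e) R E"
    by (simp only: finitely_cogenerated_def ex_simps envs)
  then show ?thesis
    unfolding iffM iffE ranked_envelope_iff[OF assms(3,4,6)] by simp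
qed

end
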